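(* Let $G$ be a $2k$-regular graph with at least $3$ vertices, and let $v$ be any vertex of $G$. Then $\mathsf M(G)$ equals the number of partitions of the edge set of $G\setminus v$ into $k$ (unordered) parts, each of which is the edge set of a spanning tree of $G\setminus v$.
   Context: Graphs are finite and undirected, and may have multiple edges and self-loops. A graph is $2k$-regular if every vertex has degree $2k$, where a self-loop counts $2$. The graph $G\setminus v$ is obtained by deleting $v$ and all edges incident to $v$. Transitions. Let $v$ be a vertex without self-loops, with incident edges $e_i=vw_i$ for $i=1,\dots,2k$. A transition at $v$ is a partition $\tau$ of $\{e_1,\dots,e_{2k}\}$ into $k$ pairs, and $\mathcal T(v)$ denotes the set of all transitions at $v$. The graph $G_\tau$ is obtained by deleting $v$ and its incident edges, and then adding a new edge $w_iw_j$ for each pair $\{e_i,e_j\}\in\tau$. Martin invariant. For a $2k$-regular graph with at least 3 vertices, $\mathsf M(G)$ is defined recursively: - $\mathsf M(G)=0$ if $G$ has a self-loop; - $\mathsf M(G)=1$ if $G$ has exactly 3 vertices and no self-loop; - otherwise $\mathsf M(G)=\sum_{\tau\in\mathcal T(v)}\mathsf M(G_\tau)$ for any vertex $v$; this is independent of the choice of $v$. *)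

theory Defs
  imports Main "HOL-Library.Uprod" "HOL-Library.Disjoint_Sets"
begin

section \<open>Finite undirected multigraphs with loops\<close>

text \<open>
  Edges are labelled, so that parallel edges are distinct objects. The field \<open>ends\<close> is only
  meaningful on \<open>edges\<close>; a self-loop at \<open>v\<close> is an edge with end pair \<open>Upair v v\<close>.
\<close>

record ('v, 'e) mgraph =
  verts :: "'v set"
  edges :: "'e set"
  ends :: "'e \<Rightarrow> 'v uprod"

definition multigraph :: "('v, 'e) mgraph \<Rightarrow> bool" where
  "multigraph G \<longleftrightarrow> finite (verts G) \<and> finite (edges G) \<and>
     (\<forall>e\<in>edges G. set_uprod (ends G e) \<subseteq> verts G)"

definition incident :: "('v, 'e) mgraph \<Rightarrow> 'v \<Rightarrow> 'e set" where
  "incident G v = {e \<in> edges G. v \<in> set_uprod (ends G e)}"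

definition loops :: "('v, 'e) mgraph \<Rightarrow> 'v \<Rightarrow> 'e set" where
  "loops G v = {e \<in> edges G. ends G e = Upair v v}"

definition has_loop :: "('v, 'e) mgraph \<Rightarrow> bool" where
  "has_loop G \<longleftrightarrow> (\<exists>v. loops G v \<noteq> {})"

text \<open>Loops also belong to \<open>incident G v\<close>, hence are counted twice.\<close>

definition degree :: "('v, 'e) mgraph \<Rightarrow> 'v \<Rightarrow> nat" where
  "degree G v = card (incident G v) + card (loops G v)"

definition regular :: "nat \<Rightarrow> ('v, 'e) mgraph \<Rightarrow> bool" where
  "regular d G \<longleftrightarrow> (\<forall>v\<in>verts G. degree G v = d)"

definition del_vertex :: "('v, 'e) mgraph \<Rightarrow> 'v \<Rightarrow> ('v, 'e) mgraph" where
  "del_vertex G v =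
     \<lparr>verts = verts G - {v}, edges = edges G - incident G v, ends = ends G\<rparr>"

section \<open>Spanning trees\<close>

text \<open>A walk is given by its vertices \<open>vs\<close> and the edges \<open>es\<close> traversed between them.\<close>

definition walk :: "('v, 'e) mgraph \<Rightarrow> 'v list \<Rightarrow> 'e list \<Rightarrow> bool" where
  "walk G vs es \<longleftrightarrow> length vs = Suc (length es) \<and> set vs \<subseteq> verts G \<and> set es \<subseteq> edges G \<and>
     (\<forall>i<length es. ends G (es ! i) = Upair (vs ! i) (vs ! Suc i))"

definition connected :: "('v, 'e) mgraph \<Rightarrow> bool" where
  "connected G \<longleftrightarrow> verts G \<noteq> {} \<and>
     (\<forall>u\<in>verts G. \<forall>w\<in>verts G. \<exists>vs es. walk G vs es \<and> hd vs = u \<and> last vs = w)"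

text \<open>A loop is a cycle of length 1, two parallel edges form a cycle of length 2.\<close>

definition cycle :: "('v, 'e) mgraph \<Rightarrow> 'v list \<Rightarrow> 'e list \<Rightarrow> bool" where
  "cycle G vs es \<longleftrightarrow> walk G vs es \<and> es \<noteq> [] \<and> hd vs = last vs \<and>
     distinct (tl vs) \<and> distinct es"

definition tree :: "('v, 'e) mgraph \<Rightarrow> bool" where
  "tree G \<longleftrightarrow> connected G \<and> (\<nexists>vs es. cycle G vs es)"

definition spanning_tree :: "('v, 'e) mgraph \<Rightarrow> 'e set \<Rightarrow> bool" where
  "spanning_tree G T \<longleftrightarrow> T \<subseteq> edges G \<and> tree (G\<lparr>edges := T\<rparr>)"

definition spanning_tree_partitions :: "('v, 'e) mgraph \<Rightarrow> nat \<Rightarrow> 'e set set set" where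
  "spanning_tree_partitions G k =
     {P. partition_on (edges G) P \<and> card P = k \<and> (\<forall>T\<in>P. spanning_tree G T)}"

section \<open>Transitions\<close>

definition transitions :: "('v, 'e) mgraph \<Rightarrow> 'v \<Rightarrow> 'e set set set" where
  "transitions G v = {\<tau>. partition_on (incident G v) \<tau> \<and> (\<forall>p\<in>\<tau>. card p = 2)}"

definition other_end :: "('v, 'e) mgraph \<Rightarrow> 'v \<Rightarrow> 'e \<Rightarrow> 'v" where
  "other_end G v e = (THE w. ends G e = Upair v w)"

definition joined_ends :: "('v, 'e) mgraph \<Rightarrow> 'v \<Rightarrow> 'e set \<Rightarrow> 'v uprod" where
  "joined_ends G v p =
     (THE u. \<exists>e f. p = {e, f} \<and> e \<noteq> f \<and> u = Upair (other_end G v e) (other_end G v f))"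

text \<open>
  The graph \<open>G\<^sub>\<tau>\<close>. The new edge replacing a pair \<open>p \<in> \<tau>\<close> needs a label not used by a surviving
  edge; we recycle one of the two labels in \<open>p\<close> (which one is immaterial, the pairs being
  disjoint). Conversely, a recycled label lies in a unique pair of \<open>\<tau>\<close>, which determines its
  new end vertices.
\<close>

definition apply_transition ::
  "('v, 'e) mgraph \<Rightarrow> 'v \<Rightarrow> 'e set set \<Rightarrow> ('v, 'e) mgraph" where
  "apply_transition G v \<tau> =
     \<lparr>verts = verts G - {v},
      edges = (edges G - incident G v) \<union> (\<lambda>p. SOME e. e \<in> p) ` \<tau>,
      ends = (\<lambda>e. if e \<in> incident G v then joined_ends G v (THE p. p \<in> \<tau> \<and> e \<in> p)
                  else ends G e)\<rparr>"

lemma other_end_eq: "ends G e = Upair v w \<Longrightarrow> other_end G v e = w"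
  unfolding other_end_def by auto

lemma joined_ends_eq:
  assumes "e \<noteq> f" "ends G e = Upair v w" "ends G f = Upair v w'"
  shows "joined_ends G v {e, f} = Upair w w'"
  unfolding joined_ends_def
proof (rule the_equality)
  show "\<exists>a b. {e, f} = {a, b} \<and> a \<noteq> b \<and> Upair w w' = Upair (other_end G v a) (other_end G v b)"
    using assms other_end_eq by metis
next
  fix u
  assume "\<exists>a b. {e, f} = {a, b} \<and> a \<noteq> b \<and> u = Upair (other_end G v a) (other_end G v b)"
  then show "u = Upair w w'"
    using assms by (auto simp: doubleton_eq_iff other_end_eq)
qed

lemma ends_apply_transition:
  assumes "\<tau> \<in> transitions G v" "{e, f} \<in> \<tau>" "e \<noteq> f"
    and "ends G e = Upair v w" "ends G f = Upair v w'"
  shows "ends (apply_transition G v \<tau>) (SOME x. x \<in> {e, f}) = Upair w w'"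
proof -
  define x where "x = (SOME x. x \<in> {e, f})"
  have x: "x \<in> {e, f}" unfolding x_def by (rule someI[of _ e]) simp
  have part: "partition_on (incident G v) \<tau>"
    using assms(1) by (simp add: transitions_def)
  have "x \<in> incident G v"
    using part x assms(2) unfolding partition_on_def by blast
  moreover have "(THE p. p \<in> \<tau> \<and> x \<in> p) = {e, f}"
  proof (rule the_equality)
    show "{e, f} \<in> \<tau> \<and> x \<in> {e, f}" using assms(2) x by blast
    show "p = {e, f}" if "p \<in> \<tau> \<and> x \<in> p" for p
      using disjointD[OF partition_onD2[OF part], of p "{e, f}"] that x assms(2) by blast
  qed
  ultimately show ?thesis
    using joined_ends_eq[OF assms(3-5)] by (simp add: apply_transition_def x_def)
qed

lemma inj_on_transition_label:
  assumes "\<tau> \<in> transitions G v"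
  shows "inj_on (\<lambda>p. SOME e. e \<in> p) \<tau>"
proof (rule inj_onI)
  fix p q
  assume pq: "p \<in> \<tau>" "q \<in> \<tau>" and eq: "(SOME e. e \<in> p) = (SOME e. e \<in> q)"
  have part: "partition_on (incident G v) \<tau>"
    using assms by (simp add: transitions_def)
  have "p \<noteq> {}" "q \<noteq> {}" using part pq unfolding partition_on_def by auto
  then have "(SOME e. e \<in> p) \<in> p" "(SOME e. e \<in> q) \<in> q"
    by (simp_all add: some_in_eq)
  then show "p = q"
    using disjointD[OF partition_onD2[OF part] pq] eq by force
qed

section \<open>The Martin invariant\<close>

text \<open>
  \<open>martin_value G m\<close> says that the recursion can be evaluated to \<open>m\<close>, where the vertex to be
  expanded may be chosen anew at every step and in every branch.
\<close>

inductive martin_value :: "('v, 'e) mgraph \<Rightarrow> nat \<Rightarrow> bool" where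
  loop: "\<lbrakk>3 \<le> card (verts G); has_loop G\<rbrakk> \<Longrightarrow> martin_value G 0"
| three: "\<lbrakk>card (verts G) = 3; \<not> has_loop G\<rbrakk> \<Longrightarrow> martin_value G 1"
| expand: "\<lbrakk>3 < card (verts G); \<not> has_loop G; v \<in> verts G;
    \<And>\<tau>. \<tau> \<in> transitions G v \<Longrightarrow> martin_value (apply_transition G v \<tau>) (m \<tau>)\<rbrakk>
    \<Longrightarrow> martin_value G (\<Sum>\<tau>\<in>transitions G v. m \<tau>)"

text \<open>For regular multigraphs the value exists and does not depend on the choices made.\<close>

definition martin :: "('v, 'e) mgraph \<Rightarrow> nat" where
  "martin G = (THE m. martin_value G m)"

end

theory Submission
  imports Defs "HOL-Library.FuncSet"
begin

text \<open>
  Let \<open>N(G, w)\<close> be the number of colourings of the edges of \<open>G \ w\<close> by \<open>k\<close> colours all of whose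
  colour classes are spanning trees; it is \<open>k!\<close> times the number of partitions into spanning trees.
  The heart of the matter is \<open>N(G, w) = \<Sum>\<^sub>\<tau> N(G\<^sub>\<tau>, w)\<close> for transitions \<open>\<tau>\<close> at a vertex \<open>v \<noteq> w\<close>.
  Induction on the number of vertices, expanding a third vertex, then shows that \<open>N(G, w)\<close> does
  not depend on \<open>w\<close>, so that \<open>N / k!\<close> satisfies the recursion of the Martin invariant.

  To prove the identity, fix the colouring of the edges avoiding \<open>v\<close> and \<open>w\<close>, with classes
  \<open>F\<^sub>i\<close>, and put \<open>d\<^sub>i = n - 2 - |F\<^sub>i|\<close>, where \<open>n\<close> is the number of vertices; this is the number
  of components of \<open>F\<^sub>i\<close> if \<open>F\<^sub>i\<close> is a forest, and otherwise both sides vanish. On the left, the edges at \<open>v\<close> are distributed so that the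
  set \<open>S\<^sub>i\<close> of colour \<open>i\<close> attaches \<open>v\<close> to every component of \<open>F\<^sub>i\<close> exactly once; on the right, \<open>S\<^sub>i\<close>
  is paired up such that the new edges complete \<open>F\<^sub>i\<close> to a tree. A tree on \<open>d\<close> vertices whose
  vertices carry prescribed half-edges \<open>S\<close> can be wired in \<open>(d - 2)!\<close> times as many ways as there
  are transversals of \<open>S\<close>. In the algebra of set functions under disjoint-union convolution, this
  says that both sides have a common factor up to factors of the form \<open>S \<mapsto> |S|! [|S| = j]\<close>, and a
  count of edges shows that the remaining factors agree.
\<close>

section \<open>Cuts and connectedness\<close>

definition crosses :: "'v set \<Rightarrow> 'v uprod \<Rightarrow> bool" where
  "crosses U u \<longleftrightarrow> (\<exists>x y. u = Upair x y \<and> x \<in> U \<and> y \<notin> U)"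

lemma crosses_Upair [simp]: "crosses U (Upair x y) \<longleftrightarrow> (x \<in> U) \<noteq> (y \<in> U)"
  unfolding crosses_def by auto

lemma crossesE:
  assumes "crosses U u"
  obtains x y where "u = Upair x y" "x \<in> U" "y \<notin> U"
  using assms unfolding crosses_def by blast

lemma crosses_cong:
  assumes "set_uprod u \<subseteq> W" "U \<inter> W = U' \<inter> W"
  shows "crosses U u \<longleftrightarrow> crosses U' u"
  using assms by (cases u) auto

text \<open>Connectedness in terms of cuts rather than walks: attaching a vertex or exchanging an
  edge then only amounts to moving a vertex across a cut. \<open>R\<close> is a set of end pairs
  without labels or multiplicities, since these do not affect connectedness; \<open>spans\<close>
  carries the number of edges separately.\<close>

definition cut_connected :: "'v set \<Rightarrow> 'v uprod set \<Rightarrow> bool" where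
  "cut_connected V R \<longleftrightarrow>
     V \<noteq> {} \<and> (\<forall>U. U \<subseteq> V \<longrightarrow> U \<noteq> {} \<longrightarrow> U \<noteq> V \<longrightarrow> (\<exists>u\<in>R. crosses U u))"

definition within :: "'v set \<Rightarrow> 'v uprod set \<Rightarrow> bool" where
  "within V R \<longleftrightarrow> (\<forall>u\<in>R. set_uprod u \<subseteq> V)"

lemma within_insert [simp]: "within V (insert u R) \<longleftrightarrow> set_uprod u \<subseteq> V \<and> within V R"
  by (auto simp: within_def)

lemma within_Un [simp]: "within V (R \<union> R') \<longleftrightarrow> within V R \<and> within V R'"
  by (auto simp: within_def)

lemma within_empty [simp]: "within V {}"
  by (auto simp: within_def)

lemma within_mono: "within V R \<Longrightarrow> R' \<subseteq> R \<Longrightarrow> V \<subseteq> V' \<Longrightarrow> within V' R'"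
  by (fastforce simp: within_def)

lemma cut_connectedD:
  assumes "cut_connected V R" "U \<subseteq> V" "x \<in> U" "y \<in> V - U"
  shows "\<exists>u\<in>R. crosses U u"
  using assms unfolding cut_connected_def by blast

lemma not_cut_connectedE:
  assumes "\<not> cut_connected V R" "V \<noteq> {}"
  obtains U where "U \<subseteq> V" "U \<noteq> {}" "U \<noteq> V" "\<And>u. u \<in> R \<Longrightarrow> \<not> crosses U u"
  using assms unfolding cut_connected_def by auto

text \<open>A maximal \<open>U\<close> containing \<open>x\<close> with property \<open>P\<close>
  must be \<open>V\<close>: otherwise some edge leaves \<open>U\<close>, and \<open>step\<close>
  adds its outer end. This is the cut form of growing a tree from \<open>x\<close>.\<close>

lemma cut_induct:
  assumes con: "cut_connected V R" and fin: "finite V" and R: "within V R"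
    and x: "x \<in> V" and base: "P {x}"
    and step: "\<And>U a b. U \<subseteq> V \<Longrightarrow> x \<in> U \<Longrightarrow> P U \<Longrightarrow> a \<in> U \<Longrightarrow> b \<in> V - U \<Longrightarrow> Upair a b \<in> R
      \<Longrightarrow> P (insert b U)"
  shows "P V"
proof -
  let ?F = "{U. U \<subseteq> V \<and> x \<in> U \<and> P U}"
  have "finite ?F" using fin by auto
  moreover have "{x} \<in> ?F" using x base by simp
  ultimately obtain U where U: "U \<in> ?F" and max: "\<And>W. W \<in> ?F \<Longrightarrow> U \<subseteq> W \<Longrightarrow> U = W"
    using finite_has_maximal2[of ?F "{x}"] by metis
  have "U = V"
  proof (rule ccontr)
    assume "U \<noteq> V"
    then obtain u where u: "u \<in> R" "crosses U u"
      using con U unfolding cut_connected_def by blast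
    then obtain a b where ab: "u = Upair a b" "a \<in> U" "b \<notin> U" by (elim crossesE)
    have "b \<in> V" using u(1) ab(1) R by (auto simp: within_def)
    then have "insert b U \<in> ?F" using step[of U a b] ab u U by auto
    then show False using max[of "insert b U"] ab by blast
  qed
  then show ?thesis using U by simp
qed

text \<open>A cut separating \<open>v\<close> from \<open>x\<close> is crossed by the new edge;
  every other cut of \<open>insert v V\<close> is determined by its trace on
  \<open>V\<close>.\<close>

lemma cut_connected_pendant:
  assumes "within V R" "v \<notin> V" "x \<in> V"
  shows "cut_connected (insert v V) (insert (Upair v x) R) \<longleftrightarrow> cut_connected V R"
proof
  assume L: "cut_connected (insert v V) (insert (Upair v x) R)"
  show "cut_connected V R"
    unfolding cut_connected_def
  proof (intro conjI allI impI)
    show "V \<noteq> {}" using assms by blast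
    fix U assume U: "U \<subseteq> V" "U \<noteq> {}" "U \<noteq> V"
    \<comment> \<open>\<open>v\<close> is put on the side of \<open>x\<close>, so that the new edge
      does not cross.\<close>
    let ?U = "if x \<in> U then insert v U else U"
    have "?U \<subseteq> insert v V" "?U \<noteq> {}" "?U \<noteq> insert v V"
      using U assms(2,3) by auto
    then have "\<exists>u\<in>insert (Upair v x) R. crosses ?U u"
      using L unfolding cut_connected_def by blast
    then obtain u where u: "u \<in> R" "crosses ?U u"
      using assms U by (auto split: if_splits)
    have "set_uprod u \<subseteq> V" using u assms(1) by (auto simp: within_def)
    then have "crosses U u" using u(2) assms(2) crosses_cong[of u V U ?U] by auto
    then show "\<exists>u\<in>R. crosses U u" using u by blast
  qed
next
  assume L: "cut_connected V R"
  show "cut_connected (insert v V) (insert (Upair v x) R)"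
    unfolding cut_connected_def
  proof (intro conjI allI impI)
    fix U assume U: "U \<subseteq> insert v V" "U \<noteq> {}" "U \<noteq> insert v V"
    show "\<exists>u\<in>insert (Upair v x) R. crosses U u"
    proof (cases "(v \<in> U) = (x \<in> U)")
      case True
      have "U - {v} \<subseteq> V" "U - {v} \<noteq> {}" "U - {v} \<noteq> V"
        using U True assms by auto
      then obtain u where u: "u \<in> R" "crosses (U - {v}) u"
        using L unfolding cut_connected_def by blast
      have "set_uprod u \<subseteq> V" using u assms(1) by (auto simp: within_def)
      then have "crosses U u" using u(2) assms(2) crosses_cong[of u V U "U - {v}"] by auto
      then show ?thesis using u by blast
    qed auto
  qed simp
qed

text \<open>In the presence of the edge from \<open>v\<close> to \<open>a\<close>, the edges
  \<open>Upair v b\<close> and \<open>Upair a b\<close> are interchangeable, because a cut not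
  crossed by \<open>Upair v a\<close> has \<open>v\<close> and \<open>a\<close> on the same side.
  After the exchange \<open>v\<close> is pendant at \<open>a\<close>.\<close>

lemma cut_connected_subdivide:
  assumes "within V R" "v \<notin> V" "a \<in> V" "b \<in> V"
  shows "cut_connected (insert v V) (insert (Upair v a) (insert (Upair v b) R))
    \<longleftrightarrow> cut_connected V (insert (Upair a b) R)"
proof -
  let ?R = "insert (Upair v a) (insert (Upair v b) R)"
  let ?R' = "insert (Upair v a) (insert (Upair a b) R)"
  have cr: "(\<exists>u\<in>?R. crosses U u) \<longleftrightarrow> (\<exists>u\<in>?R'. crosses U u)" for U
    by auto
  have "cut_connected (insert v V) ?R \<longleftrightarrow> cut_connected (insert v V) ?R'"
    unfolding cut_connected_def cr ..
  also have "\<dots> \<longleftrightarrow> cut_connected V (insert (Upair a b) R)"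
    using assms by (intro cut_connected_pendant) auto
  finally show ?thesis .
qed

section \<open>Spanning trees and exchange of edges in terms of cuts\<close>

text \<open>While the vertex set grows along \<open>cut_induct\<close>, one edge is taken for each
  new vertex. Edges are indices in \<open>A\<close> with end pairs given by \<open>p\<close>, so
  that parallel edges count separately.\<close>

lemma cut_connected_spanning_tree:
  assumes con: "cut_connected V (p ` A)" and fin: "finite V" "finite A" and w: "within V (p ` A)"
  shows "\<exists>B\<subseteq>A. card B + 1 = card V \<and> cut_connected V (p ` B)"
proof -
  obtain x where x: "x \<in> V" using con unfolding cut_connected_def by blast
  let ?P = "\<lambda>U. finite U \<and> (\<exists>B\<subseteq>A. card B + 1 = card U \<and> within U (p ` B) \<and> cut_connected U (p ` B))"
  have "?P V"
  proof (rule cut_induct[where P = ?P, OF con fin(1) w x])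
    show "?P {x}"
      by (auto simp: cut_connected_def intro!: exI[of _ "{}"])
  next
    fix U a b
    assume "U \<subseteq> V" "x \<in> U" and U: "?P U" and ab: "a \<in> U" "b \<in> V - U" "Upair a b \<in> p ` A"
    from U obtain B where B: "B \<subseteq> A" "card B + 1 = card U" "within U (p ` B)"
      "cut_connected U (p ` B)" by blast
    obtain e where e: "e \<in> A" "p e = Upair a b" using ab by auto
    \<comment> \<open>Edges of \<open>B\<close> have both ends in \<open>U\<close>, whereas
      \<open>b\<close> lies outside; so the number of edges rises by exactly one.\<close>
    have "e \<notin> B"
    proof
      assume "e \<in> B"
      then have "set_uprod (p e) \<subseteq> U" using B(3) unfolding within_def by blast
      then show False using e ab by simp
    qed
    then have "card (insert e B) + 1 = card (insert b U)"
      using B(1,2) U ab fin(2) by (simp add: finite_subset)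
    moreover have sym: "Upair a b = Upair b a" by simp
    have "cut_connected (insert b U) (p ` insert e B)"
      using cut_connected_pendant[OF B(3), of b a] B(4) ab e
      by (simp add: sym)
    moreover have "within (insert b U) (p ` insert e B)"
      using B(3) e ab within_mono[OF B(3), of _ "insert b U"] by auto
    ultimately show "?P (insert b U)"
      using U B(1) e(1) by (intro conjI exI[of _ "insert e B"]) auto
  qed
  then show ?thesis by blast
qed

lemma cut_connected_card:
  assumes "cut_connected V (p ` A)" "finite V" "finite A" "within V (p ` A)"
  shows "card V \<le> card A + 1"
proof -
  obtain B where "B \<subseteq> A" "card B + 1 = card V" using cut_connected_spanning_tree[OF assms] by blast
  then show ?thesis using card_mono[OF assms(3), of B] by simp
qed

text \<open>\<open>R\<close> has exactly two components, one containing \<open>x\<close> and one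
  containing \<open>y\<close>. The vertex \<open>z\<close> lies in exactly one of them, so exactly
  one of the two edges at \<open>z\<close> reconnects \<open>R\<close>. The proof handles unions of
  components, the \<open>closed\<close> sets, which are stable under complement and symmetric
  difference.\<close>

lemma cut_connected_triangle:
  assumes ncon: "\<not> cut_connected V R" and con: "cut_connected V (insert (Upair x y) R)"
    and V: "x \<in> V" "y \<in> V" "z \<in> V" and R: "within V R"
  shows "cut_connected V (insert (Upair x z) R) \<longleftrightarrow> \<not> cut_connected V (insert (Upair y z) R)"
proof -
  define closed where "closed = (\<lambda>U. U \<subseteq> V \<and> (\<forall>u\<in>R. \<not> crosses U u))"
  have compl: "closed (V - U)" if "closed U" for U
    unfolding closed_def
  proof (intro conjI ballI)
    fix u assume u: "u \<in> R"
    then have "set_uprod u \<subseteq> V" "\<not> crosses U u" using R that by (auto simp: within_def closed_def)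
    then show "\<not> crosses (V - U) u" by (cases u) auto
  qed auto
  have diff: "closed ((U - W) \<union> (W - U))" if "closed U" "closed W" for U W
    unfolding closed_def
  proof (intro conjI ballI)
    fix u assume u: "u \<in> R"
    then have "\<not> crosses U u" "\<not> crosses W u" using that by (auto simp: closed_def)
    then show "\<not> crosses (U - W \<union> (W - U)) u" by (cases u) auto
  qed (use that in \<open>auto simp: closed_def\<close>)
  have nc: "\<not> cut_connected V (insert (Upair a b) R)"
    if "closed U" "U \<noteq> {}" "U \<noteq> V" "(a \<in> U) = (b \<in> U)" for U a b
    using that unfolding closed_def cut_connected_def by auto
  \<comment> \<open>Passing to the complement if necessary, the uncrossed cut can be chosen to
    contain a prescribed vertex \<open>c\<close>.\<close>
  have ex: "\<exists>U. closed U \<and> c \<in> U \<and> U \<noteq> V \<and> (a \<in> U) = (b \<in> U)"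
    if "\<not> cut_connected V (insert (Upair a b) R)" "a \<in> V" "b \<in> V" "c \<in> V" for a b c
  proof -
    from that have "V \<noteq> {}" by blast
    from not_cut_connectedE[OF that(1) this] obtain U where U0: "U \<subseteq> V" "U \<noteq> {}" "U \<noteq> V"
      "\<And>u. u \<in> insert (Upair a b) R \<Longrightarrow> \<not> crosses U u" by metis
    have U: "closed U" "U \<noteq> {}" "U \<noteq> V" "(a \<in> U) = (b \<in> U)"
      using U0(1-3) U0(4)[of "Upair a b"] U0(4) by (simp_all add: closed_def)
    have "closed (V - U)" "V - U \<noteq> {}" "V - U \<noteq> V" "(a \<in> V - U) = (b \<in> V - U)"
      using compl[OF U(1)] U that by (auto simp: closed_def)
    then show ?thesis using U that by blast
  qed
  obtain U0 where U0: "closed U0" "U0 \<noteq> {}" "U0 \<noteq> V"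
    using not_cut_connectedE[OF ncon] V unfolding closed_def by (metis empty_iff)
  show ?thesis
  proof
    assume "cut_connected V (insert (Upair x z) R)"
    then show "\<not> cut_connected V (insert (Upair y z) R)"
      using nc[OF U0] con by metis
  next
    assume 1: "\<not> cut_connected V (insert (Upair y z) R)"
    show "cut_connected V (insert (Upair x z) R)"
    proof (rule ccontr)
      assume 2: "\<not> cut_connected V (insert (Upair x z) R)"
      obtain U where U: "closed U" "z \<in> U" "U \<noteq> V" "(x \<in> U) = (z \<in> U)"
        using ex[OF 2, of z] V by blast
      obtain W where W: "closed W" "x \<in> W" "W \<noteq> V" "(y \<in> W) = (z \<in> W)"
        using ex[OF 1, of x] V by blast
      have "y \<notin> U" using nc[OF U(1), of x y] U con by blast
      moreover have "y \<notin> W" using nc[OF W(1), of x y] W con by blast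
      \<comment> \<open>\<open>x\<close> lies in both \<open>U\<close> and \<open>W\<close>, and
        \<open>y\<close> in neither, so their symmetric difference contains neither vertex. It does
        contain \<open>z\<close>, and hence is a nonempty proper closed set with \<open>x\<close>
        and \<open>y\<close> on the same side.\<close>
      ultimately show False
        using nc[OF diff[OF U(1) W(1)], of x y] U W con V by blast
    qed
  qed
qed

text \<open>Deleting the star vertex \<open>v\<close> from a spanning tree leaves one branch for each edge at \<open>v\<close>;
  the edge in question is the one whose branch contains \<open>b\<close>.\<close>

lemma unique_exchangeable_star_edge:
  assumes R: "within V R" "finite R" and v: "v \<notin> V" and fin: "finite V" and q: "q ` T \<subseteq> V"
    and b: "b \<in> V" and finT: "finite T" and le: "card R + card T \<le> card V"
    and con: "cut_connected (insert v V) (R \<union> (\<lambda>a. Upair v (q a)) ` T)"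
  shows "\<exists>!a. a \<in> T \<and>
    cut_connected (insert v V) (insert (Upair v b) (R \<union> (\<lambda>a. Upair v (q a)) ` (T - {a})))"
proof -
  define X where "X = (\<lambda>a. R \<union> (\<lambda>a. Upair v (q a)) ` (T - {a}))"
  define G where "G = R \<union> (\<lambda>a. Upair v (q a)) ` T"
  have X: "insert (Upair v (q a)) (X a) = G" if "a \<in> T" for a
  proof -
    have "(\<lambda>a. Upair v (q a)) ` T = (\<lambda>a. Upair v (q a)) ` insert a (T - {a})"
      using that by (simp add: insert_absorb)
    then show ?thesis unfolding X_def G_def image_insert by simp
  qed
  have wX: "within (insert v V) (X a)" for a
    using R(1) q by (auto simp: X_def within_def)
  \<comment> \<open>At most \<open>card V - 1\<close> edges remain, one fewer than is needed to
    connect \<open>card V + 1\<close> vertices.\<close>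
  have ncon: "\<not> cut_connected (insert v V) (X a)" if "a \<in> T" for a
  proof
    assume "cut_connected (insert v V) (X a)"
    then have "card (insert v V) \<le> card (X a) + 1"
      using cut_connected_card[of "insert v V" id "X a"] wX fin R(2) finT by (simp add: X_def)
    also have "card (X a) \<le> card R + card ((\<lambda>a. Upair v (q a)) ` (T - {a}))"
      unfolding X_def by (rule card_Un_le)
    also have "card ((\<lambda>a. Upair v (q a)) ` (T - {a})) \<le> card (T - {a})"
      using finT by (intro card_image_le) auto
    finally show False
      using that finT fin v le card_Suc_Diff1[of T a] by simp
  qed
  have "\<exists>U. U \<subseteq> V \<and> q a \<in> U \<and> (\<forall>u\<in>X a. \<not> crosses U u)" if a: "a \<in> T" for a
  proof -
    obtain U where U: "U \<subseteq> insert v V" "U \<noteq> {}" "U \<noteq> insert v V" "\<And>u. u \<in> X a \<Longrightarrow> \<not> crosses U u"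
      using not_cut_connectedE[OF ncon[OF a]] by (metis insert_not_empty)
    \<comment> \<open>The side of the cut that avoids \<open>v\<close>. It contains
      \<open>q a\<close>, since in the full graph only the removed star edge can cross it; it serves
      as the branch \<open>U a\<close>.\<close>
    define W where "W = (if v \<in> U then insert v V - U else U)"
    have W: "W \<subseteq> V" "W \<noteq> {}" using U by (auto simp: W_def)
    have nc: "\<not> crosses W u" if "u \<in> X a" for u
      using U(4)[OF that] wX[of a] that by (cases u) (auto simp: W_def within_def)
    have "\<exists>u\<in>G. crosses W u"
      using con W v unfolding cut_connected_def G_def[symmetric] by blast
    then have "crosses W (Upair v (q a))" using X[OF a] nc by blast
    then have "q a \<in> W" using W v by auto
    then show ?thesis using W nc by blast
  qed
  then obtain U where U: "\<And>a. a \<in> T \<Longrightarrow> U a \<subseteq> V" "\<And>a. a \<in> T \<Longrightarrow> q a \<in> U a"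
    "\<And>a u. a \<in> T \<Longrightarrow> u \<in> X a \<Longrightarrow> \<not> crosses (U a) u" by metis
  have iff: "cut_connected (insert v V) (insert (Upair v b) (X a)) \<longleftrightarrow> b \<in> U a" if a: "a \<in> T" for a
  proof
    assume con': "cut_connected (insert v V) (insert (Upair v b) (X a))"
    have "\<exists>u\<in>insert (Upair v b) (X a). crosses (U a) u"
      by (rule cut_connectedD[OF con', of "U a" "q a" v]) (use U a v in auto)
    then show "b \<in> U a" using U a v by auto
  next
    assume bU: "b \<in> U a"
    show "cut_connected (insert v V) (insert (Upair v b) (X a))"
    proof (rule ccontr)
      assume "\<not> ?thesis"
      moreover have "cut_connected (insert v V) (insert (Upair v (q a)) (X a))"
        using X[OF a] con by (simp add: G_def)
      ultimately have con': "cut_connected (insert v V) (insert (Upair (q a) b) (X a))"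
        using cut_connected_triangle[OF ncon[OF a], of v "q a" b] b q a wX by auto
      have "\<exists>u\<in>insert (Upair (q a) b) (X a). crosses (U a) u"
        by (rule cut_connectedD[OF con', of "U a" "q a" v]) (use U a v in auto)
      then show False using bU U a by auto
    qed
  qed
  \<comment> \<open>Otherwise the part of \<open>V\<close> outside all branches would contain
    \<open>b\<close> and be crossed by no edge, contrary to \<open>con\<close>.\<close>
  have "\<exists>a. a \<in> T \<and> b \<in> U a"
  proof (rule ccontr)
    assume *: "\<nexists>a. a \<in> T \<and> b \<in> U a"
    let ?W = "V - (\<Union>a\<in>T. U a)"
    have "\<exists>u\<in>G. crosses ?W u"
      by (rule cut_connectedD[OF con[folded G_def], of ?W b v]) (use * b v in auto)
    then obtain u where u: "u \<in> G" "crosses ?W u" by blast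
    show False
    proof (cases "u \<in> R")
      case True
      obtain x y where xy: "u = Upair x y" "x \<in> ?W" "y \<notin> ?W"
        using crossesE[OF u(2)] by metis
      have "y \<in> V" using True R(1) xy(1) by (auto simp: within_def)
      then obtain a where a: "a \<in> T" "y \<in> U a" using xy by auto
      have "\<not> crosses (U a) u" using U(3)[OF a(1)] True by (simp add: X_def)
      then show False using xy a by simp
    next
      case False
      then obtain a where "a \<in> T" "u = Upair v (q a)" using u(1) by (auto simp: G_def)
      then show False using u(2) U(2) v by auto
    qed
  qed
  \<comment> \<open>Otherwise the intersection of two branches would be nonempty and uncrossed: the
    star edge of \<open>c\<close> cannot enter it, since \<open>c\<close> differs from
    \<open>a\<close> or from \<open>a'\<close>.\<close>
  moreover have "a = a'" if "a \<in> T" "b \<in> U a" "a' \<in> T" "b \<in> U a'" for a a'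
  proof (rule ccontr)
    assume ne: "a \<noteq> a'"
    let ?W = "U a \<inter> U a'"
    have "\<exists>u\<in>G. crosses ?W u"
    proof (rule cut_connectedD[OF con[folded G_def], of ?W b v])
      show "?W \<subseteq> insert v V" "v \<in> insert v V - ?W" using U(1)[OF that(1)] v by blast+
    qed (use that in simp)
    then obtain u where u: "u \<in> G" "crosses ?W u" by blast
    have star: "q c \<notin> U d" if "c \<in> T" "d \<in> T" "c \<noteq> d" for c d
    proof -
      have "Upair v (q c) \<in> X d" using that unfolding X_def by blast
      then have "\<not> crosses (U d) (Upair v (q c))" using U(3)[OF that(2)] by blast
      then show ?thesis using U(1)[OF that(2)] v by auto
    qed
    show False
    proof (cases "u \<in> R")
      case True
      then have "\<not> crosses (U a) u" "\<not> crosses (U a') u"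
        using U(3)[OF that(1)] U(3)[OF that(3)] by (simp_all add: X_def)
      then show False using u(2) by (cases u) auto
    next
      case False
      then obtain c where c: "c \<in> T" "u = Upair v (q c)" using u(1) by (auto simp: G_def)
      have "q c \<notin> ?W"
        using star[OF c(1) that(1)] star[OF c(1) that(3)] ne by blast
      then show False using u(2) U(1)[OF that(1)] v c(2) by auto
    qed
  qed
  ultimately show ?thesis using iff unfolding X_def by blast
qed

section \<open>Pairings\<close>

text \<open>The analogue of \<open>transitions\<close> for an arbitrary set, because subsets of the
  edges at \<open>v\<close> have to be paired as well.\<close>

definition pairings :: "'a set \<Rightarrow> 'a set set set" where
  "pairings A = {\<mu>. partition_on A \<mu> \<and> (\<forall>p\<in>\<mu>. card p = 2)}"

definition pairs :: "'a set \<Rightarrow> 'a set set" where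
  "pairs A = {p. p \<subseteq> A \<and> card p = 2}"

lemma finite_pairs: "finite A \<Longrightarrow> finite (pairs A)"
  unfolding pairs_def by (rule finite_subset[of _ "Pow A"]) auto

lemma finite_pairings: "finite A \<Longrightarrow> finite (pairings A)"
  unfolding pairings_def
  by (rule finite_subset[of _ "Pow (Pow A)"]) (auto simp: partition_on_def)

lemma pairings_Union: "\<mu> \<in> pairings A \<Longrightarrow> \<Union>\<mu> = A"
  by (simp add: pairings_def partition_on_def)

lemma pairings_pairs: "\<mu> \<in> pairings A \<Longrightarrow> p \<in> \<mu> \<Longrightarrow> p \<in> pairs A"
  by (auto simp: pairings_def pairs_def partition_on_def)

lemma pairings_finite: "\<mu> \<in> pairings A \<Longrightarrow> finite A \<Longrightarrow> finite \<mu>"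
  using finite_subset[of \<mu> "Pow A"] by (auto simp: pairings_def partition_on_def)

lemma pairings_disjoint: "\<mu> \<in> pairings A \<Longrightarrow> p \<in> \<mu> \<Longrightarrow> p' \<in> \<mu> \<Longrightarrow> p \<noteq> p' \<Longrightarrow> p \<inter> p' = {}"
  by (auto simp: pairings_def dest: partition_onD2 disjointD)

lemma pairings_iff:
  "\<mu> \<in> pairings A \<longleftrightarrow> \<Union>\<mu> = A \<and> (\<forall>p\<in>\<mu>. card p = 2) \<and>
     (\<forall>p\<in>\<mu>. \<forall>p'\<in>\<mu>. p \<noteq> p' \<longrightarrow> p \<inter> p' = {})"
  by (fastforce simp: pairings_def partition_on_def disjoint_def)

lemma card_pairings: "\<mu> \<in> pairings A \<Longrightarrow> finite A \<Longrightarrow> card A = 2 * card \<mu>"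
proof -
  assume \<mu>: "\<mu> \<in> pairings A" and A: "finite A"
  have "card (\<Union>\<mu>) = sum card \<mu>"
  proof (rule card_Union_disjoint)
    show "pairwise disjnt \<mu>"
      using pairings_disjoint[OF \<mu>] by (simp add: pairwise_def disjnt_def)
    show "finite p" if "p \<in> \<mu>" for p
      using pairings_pairs[OF \<mu> that] A by (auto simp: pairs_def intro: finite_subset)
  qed
  also have "\<dots> = 2 * card \<mu>"
    using \<mu> by (simp add: pairings_def)
  finally show ?thesis using pairings_Union[OF \<mu>] by simp
qed

lemma pairings_empty [simp]: "pairings {} = {{}}"
proof -
  have "\<mu> = {}" if "\<mu> \<in> pairings {}" for \<mu> :: "'a set set"
    using that pairings_Union[OF that] unfolding pairings_iff by fastforce
  moreover have "{} \<in> pairings ({} :: 'a set)" by (simp add: pairings_iff)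
  ultimately show ?thesis by blast
qed

lemma pairs_doubleton:
  assumes "p \<in> pairs A"
  obtains a b where "p = {a, b}" "a \<noteq> b" "a \<in> A" "b \<in> A"
  using assms by (auto simp: pairs_def card_2_iff)

lemma pairings_insert:
  assumes "p \<in> pairs A" "\<mu> \<in> pairings (A - p)"
  shows "insert p \<mu> \<in> pairings A" "p \<notin> \<mu>"
proof -
  have U: "\<Union>\<mu> = A - p" using assms(2) by (rule pairings_Union)
  then have "p \<inter> p' = {}" if "p' \<in> \<mu>" for p' using that by blast
  then show "insert p \<mu> \<in> pairings A"
    using assms U by (auto simp: pairings_iff pairs_def)
  have "p \<noteq> {}" using assms(1) by (auto simp: pairs_def)
  then show "p \<notin> \<mu>" using U by blast
qed

lemma pairings_subset:
  assumes "\<mu> \<in> pairings A" "\<nu> \<subseteq> \<mu>"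
  shows "\<nu> \<in> pairings (\<Union>\<nu>)" "\<mu> - \<nu> \<in> pairings (A - \<Union>\<nu>)"
proof -
  show "\<nu> \<in> pairings (\<Union>\<nu>)" using assms unfolding pairings_iff by blast
  have "\<Union>(\<mu> - \<nu>) = A - \<Union>\<nu>"
  proof
    show "\<Union>(\<mu> - \<nu>) \<subseteq> A - \<Union>\<nu>"
    proof
      fix x assume "x \<in> \<Union>(\<mu> - \<nu>)"
      then obtain p where p: "p \<in> \<mu>" "p \<notin> \<nu>" "x \<in> p" by blast
      have "x \<notin> p'" if "p' \<in> \<nu>" for p'
        using pairings_disjoint[OF assms(1) p(1), of p'] that assms(2) p by blast
      then show "x \<in> A - \<Union>\<nu>" using pairings_Union[OF assms(1)] p by blast
    qed
    show "A - \<Union>\<nu> \<subseteq> \<Union>(\<mu> - \<nu>)" using pairings_Union[OF assms(1)] by blast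
  qed
  then show "\<mu> - \<nu> \<in> pairings (A - \<Union>\<nu>)" using assms unfolding pairings_iff by blast
qed

lemma pairings_union:
  assumes "\<mu> \<in> pairings A" "\<nu> \<in> pairings B" "A \<inter> B = {}"
  shows "\<mu> \<union> \<nu> \<in> pairings (A \<union> B)" "\<mu> \<inter> \<nu> = {}"
proof -
  have U: "\<Union>\<mu> = A" "\<Union>\<nu> = B" using assms by (auto dest: pairings_Union)
  have d: "p \<inter> p' = {}" if "p \<in> \<mu>" "p' \<in> \<nu>" for p p' using that U assms(3) by blast
  then show "\<mu> \<union> \<nu> \<in> pairings (A \<union> B)"
    using assms(1,2) U unfolding pairings_iff by (simp add: ball_Un) (metis Int_commute)
  have "p \<noteq> {}" if "p \<in> \<mu>" for p using that assms(1) unfolding pairings_iff by force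
  then show "\<mu> \<inter> \<nu> = {}" using d by blast
qed

section \<open>Sums over pairings\<close>

text \<open>Double count of the pairings with a distinguished pair: removing the pair
  \<open>p\<close> leaves a pairing of \<open>A - p\<close>.\<close>

lemma sum_pairings_pick:
  assumes "finite A"
  shows "(\<Sum>\<mu>\<in>pairings A. \<Sum>p\<in>\<mu>. h p \<mu>) = (\<Sum>p\<in>pairs A. \<Sum>\<mu>\<in>pairings (A - p). h p (insert p \<mu>))"
proof -
  have "(\<Sum>\<mu>\<in>pairings A. \<Sum>p\<in>\<mu>. h p \<mu>) = (\<Sum>(\<mu>, p)\<in>Sigma (pairings A) (\<lambda>\<mu>. \<mu>). h p \<mu>)"
    using assms by (intro sum.Sigma) (auto intro: finite_pairings pairings_finite)
  also have "\<dots> = (\<Sum>(p, \<mu>)\<in>Sigma (pairs A) (\<lambda>p. pairings (A - p)). h p (insert p \<mu>))"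
  proof (rule sum.reindex_bij_witness[where i = "\<lambda>(p, \<mu>). (insert p \<mu>, p)" and j = "\<lambda>(\<mu>, p). (p, \<mu> - {p})"],
      goal_cases)
    case (2 x)
    then show ?case
      using pairings_subset(2)[of "fst x" A "{snd x}"] by (auto dest: pairings_pairs)
  next
    case (4 x)
    then show ?case using pairings_insert[of "fst x" A "snd x"] by (cases x) auto
  next
    case (3 x)
    then show ?case using pairings_insert[of "fst x" A "snd x"] by (cases x) auto
  qed (auto simp: insert_absorb)
  also have "\<dots> = (\<Sum>p\<in>pairs A. \<Sum>\<mu>\<in>pairings (A - p). h p (insert p \<mu>))"
    using assms by (intro sum.Sigma[symmetric]) (auto intro: finite_pairings finite_pairs)
  finally show ?thesis .
qed

text \<open>A sub-pairing is a pairing of the set \<open>B\<close> that it covers, and the remaining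
  pairs form a pairing of \<open>A - B\<close>. This turns a convolution over sets of pairs into one
  over sets of half-edges.\<close>

lemma sum_pairings_split:
  assumes "finite A"
  shows "(\<Sum>\<mu>\<in>pairings A. \<Sum>\<nu>\<in>Pow \<mu>. h \<nu> (\<mu> - \<nu>)) =
    (\<Sum>B\<in>Pow A. \<Sum>\<nu>\<in>pairings B. \<Sum>\<mu>\<in>pairings (A - B). h \<nu> \<mu>)"
proof -
  have "(\<Sum>\<mu>\<in>pairings A. \<Sum>\<nu>\<in>Pow \<mu>. h \<nu> (\<mu> - \<nu>)) = (\<Sum>(\<mu>, \<nu>)\<in>Sigma (pairings A) Pow. h \<nu> (\<mu> - \<nu>))"
    using assms by (intro sum.Sigma) (auto intro: finite_pairings pairings_finite)
  also have "\<dots> = (\<Sum>(B, \<nu>, \<mu>)\<in>Sigma (Pow A) (\<lambda>B. pairings B \<times> pairings (A - B)). h \<nu> \<mu>)"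
  proof (rule sum.reindex_bij_witness[where i = "\<lambda>(B, \<nu>, \<mu>). (\<nu> \<union> \<mu>, \<nu>)"
        and j = "\<lambda>(\<mu>, \<nu>). (\<Union>\<nu>, \<nu>, \<mu> - \<nu>)"], goal_cases)
    case (2 x)
    obtain \<mu> \<nu> where x: "x = (\<mu>, \<nu>)" "\<mu> \<in> pairings A" "\<nu> \<subseteq> \<mu>" using 2 by auto
    then have "\<Union>\<nu> \<subseteq> A" using pairings_Union by blast
    then show ?case using pairings_subset[OF x(2,3)] x(1) by auto
  next
    case (3 x)
    obtain B \<nu> \<mu> where x: "x = (B, \<nu>, \<mu>)" "B \<subseteq> A" "\<nu> \<in> pairings B" "\<mu> \<in> pairings (A - B)"
      using 3 by auto
    then show ?case using pairings_union(2)[OF x(3,4)] pairings_Union[OF x(3)] by auto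
  next
    case (4 x)
    obtain B \<nu> \<mu> where x: "x = (B, \<nu>, \<mu>)" "B \<subseteq> A" "\<nu> \<in> pairings B" "\<mu> \<in> pairings (A - B)"
      using 4 by auto
    then have "B \<union> (A - B) = A" by blast
    then show ?case using pairings_union(1)[OF x(3,4)] x by auto
  qed auto
  also have "\<dots> = (\<Sum>B\<in>Pow A. \<Sum>(\<nu>, \<mu>)\<in>pairings B \<times> pairings (A - B). h \<nu> \<mu>)"
    using assms by (intro sum.Sigma[symmetric])
      (auto intro!: finite_cartesian_product finite_pairings dest: finite_subset)
  also have "\<dots> = (\<Sum>B\<in>Pow A. \<Sum>\<nu>\<in>pairings B. \<Sum>\<mu>\<in>pairings (A - B). h \<nu> \<mu>)"
    by (simp add: sum.cartesian_product)
  finally show ?thesis .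
qed

text \<open>The pairings are sorted by the partner \<open>a\<close> of \<open>c\<close>;
  distinguishing the unique pair that contains \<open>c\<close> reduces this to
  \<open>sum_pairings_pick\<close>.\<close>

lemma sum_pairings_insert:
  assumes "finite A" "c \<notin> A"
  shows "(\<Sum>\<mu>\<in>pairings (insert c A). g \<mu>) = (\<Sum>a\<in>A. \<Sum>\<mu>\<in>pairings (A - {a}). g (insert {a, c} \<mu>))"
    (is "?L = ?R")
proof -
  let ?A = "insert c A"
  have "?L = (\<Sum>\<mu>\<in>pairings ?A. \<Sum>p\<in>\<mu>. if c \<in> p then g \<mu> else 0)"
  proof (rule sum.cong[OF refl])
    fix \<mu> assume \<mu>: "\<mu> \<in> pairings ?A"
    then obtain p where p: "p \<in> \<mu>" "c \<in> p" using pairings_Union by blast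
    have "(\<Sum>p\<in>\<mu>. if c \<in> p then g \<mu> else 0) = (\<Sum>p'\<in>\<mu>. if p' = p then g \<mu> else 0)"
      using pairings_disjoint[OF \<mu> p(1)] p by (intro sum.cong) auto
    also have "\<dots> = g \<mu>" using pairings_finite[OF \<mu>] assms(1) p(1) by simp
    finally show "g \<mu> = (\<Sum>p\<in>\<mu>. if c \<in> p then g \<mu> else 0)" ..
  qed
  also have "\<dots> = (\<Sum>p\<in>pairs ?A. \<Sum>\<mu>\<in>pairings (?A - p). if c \<in> p then g (insert p \<mu>) else 0)"
    using assms(1) by (subst sum_pairings_pick) auto
  also have "\<dots> = (\<Sum>p\<in>{p \<in> pairs ?A. c \<in> p}. \<Sum>\<mu>\<in>pairings (?A - p). g (insert p \<mu>))"
    using assms(1) by (intro sum.mono_neutral_cong_right) (auto intro: finite_pairs finite_pairings)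
  also have "{p \<in> pairs ?A. c \<in> p} = (\<lambda>a. {a, c}) ` A"
    using assms(2) by (auto simp: pairs_def card_2_iff)
  also have "(\<Sum>p\<in>(\<lambda>a. {a, c}) ` A. \<Sum>\<mu>\<in>pairings (?A - p). g (insert p \<mu>)) =
      (\<Sum>a\<in>A. \<Sum>\<mu>\<in>pairings (?A - {a, c}). g (insert {a, c} \<mu>))"
    by (subst sum.reindex) (auto simp: inj_on_def doubleton_eq_iff)
  also have "\<dots> = ?R"
  proof (rule sum.cong[OF refl])
    fix a assume "a \<in> A"
    have "?A - {a, c} = A - {a}" using assms(2) by auto
    then show "(\<Sum>\<mu>\<in>pairings (?A - {a, c}). g (insert {a, c} \<mu>)) =
      (\<Sum>\<mu>\<in>pairings (A - {a}). g (insert {a, c} \<mu>))" by simp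
  qed
  finally show ?thesis .
qed

section \<open>Completing a forest to a tree\<close>

text \<open>\<open>joined_ends\<close> with the map to the other end as a parameter
  \<open>q\<close>, so that the enumeration needs no graph: the elements of \<open>S\<close> are
  half-edges, and \<open>a\<close> is attached at \<open>q a\<close>.\<close>

definition join :: "('e \<Rightarrow> 'v) \<Rightarrow> 'e set \<Rightarrow> 'v uprod" where
  "join q p = (THE u. \<exists>e f. p = {e, f} \<and> e \<noteq> f \<and> u = Upair (q e) (q f))"

lemma join_eq: "a \<noteq> b \<Longrightarrow> join q {a, b} = Upair (q a) (q b)"
  unfolding join_def by (rule the_equality) (auto simp: doubleton_eq_iff)

text \<open>\<open>n\<close> is the number of edges; it may exceed \<open>card R\<close>, since \<open>R\<close> forgets multiplicities.\<close>

definition spans :: "'v set \<Rightarrow> nat \<Rightarrow> 'v uprod set \<Rightarrow> bool" where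
  "spans V n R \<longleftrightarrow> n + 1 = card V \<and> cut_connected V R"

definition star :: "'v \<Rightarrow> ('e \<Rightarrow> 'v) \<Rightarrow> 'e set \<Rightarrow> 'v uprod set" where
  "star v q T = (\<lambda>a. Upair v (q a)) ` T"

text \<open>For \<open>v\<close> outside \<open>V\<close> and \<open>R\<close> a forest with
  \<open>n\<close> edges, these are the transversals: the sets \<open>T\<close> of half-edges with
  exactly one in each component of \<open>R\<close>. The auxiliary vertex \<open>v\<close> expresses
  this without mentioning components.\<close>

definition tree_stars :: "'v set \<Rightarrow> 'v \<Rightarrow> ('e \<Rightarrow> 'v) \<Rightarrow> nat \<Rightarrow> 'v uprod set \<Rightarrow> 'e set \<Rightarrow> 'e set set" where
  "tree_stars V v q n R S = {T. T \<subseteq> S \<and> spans (insert v V) (n + card T) (R \<union> star v q T)}"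

definition tree_pairings :: "'v set \<Rightarrow> ('e \<Rightarrow> 'v) \<Rightarrow> nat \<Rightarrow> 'v uprod set \<Rightarrow> 'e set \<Rightarrow> 'e set set set" where
  "tree_pairings V q n R S = {\<mu> \<in> pairings S. spans V (n + card \<mu>) (R \<union> join q ` \<mu>)}"

lemma star_insert [simp]: "star v q (insert a T) = insert (Upair v (q a)) (star v q T)"
  by (simp add: star_def)

lemma finite_tree_stars: "finite S \<Longrightarrow> finite (tree_stars V v q n R S)"
  by (rule finite_subset[of _ "Pow S"]) (auto simp: tree_stars_def)

section \<open>Enumeration of trees with prescribed half-edges\<close>

text \<open>Read for a forest \<open>R\<close> with \<open>d\<close> components, this is a bijective
  count. A transversal \<open>T\<close>, some \<open>b\<close> in \<open>S - T\<close> and some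
  \<open>a\<close> in \<open>T\<close> attached to a component other than that of \<open>b\<close>
  yield the pair \<open>{a, b}\<close> and the transversal \<open>T - {a}\<close> of the forest with
  that pair joined. There are \<open>card S - d\<close> choices for \<open>b\<close> and
  \<open>d - 1\<close> for \<open>a\<close>.\<close>

lemma sum_tree_stars_pick:
  assumes fin: "finite V" "finite S" "finite R" and w: "within V R" and v: "v \<notin> V"
    and q: "q ` S \<subseteq> V" and n: "card R \<le> n" "n + d = card V"
  shows "(\<Sum>p\<in>pairs S. card (tree_stars V v q (n + 1) (insert (join q p) R) (S - p))) =
    card (tree_stars V v q n R S) * ((card S - d) * (d - 1))"
proof -
  let ?con = "\<lambda>T. cut_connected (insert v V) (R \<union> star v q T)"
  have cV: "card (insert v V) = n + d + 1" using fin(1) v n by simp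
  have TS: "T \<in> tree_stars V v q n R S \<longleftrightarrow> T \<subseteq> S \<and> card T = d \<and> ?con T" for T
    by (auto simp: tree_stars_def spans_def cV)
  have TS': "T \<in> tree_stars V v q (n + 1) (insert (join q {a, b}) R) (S - {a, b}) \<longleftrightarrow>
      T \<subseteq> S - {a, b} \<and> card T + 1 = d \<and>
        cut_connected (insert v V) (insert (Upair (q a) (q b)) (R \<union> star v q T))"
    if "a \<noteq> b" for T a b
    using that by (auto simp: tree_stars_def spans_def cV join_eq)
  have wst: "within (insert v V) (R \<union> star v q T)" if "T \<subseteq> S" for T
  proof -
    have "within (insert v V) R" using w by (rule within_mono) auto
    moreover have "within (insert v V) (star v q T)" using that q by (auto simp: star_def within_def)
    ultimately show ?thesis by simp
  qed
  \<comment> \<open>A connected graph on \<open>insert v V\<close> has at least \<open>n + d\<close>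
    edges, so fewer than \<open>d\<close> half-edges do not suffice.\<close>
  have ncon: "\<not> ?con T" if "T \<subseteq> S" "card T < d" for T
  proof
    assume "?con T"
    moreover have "finite T" using that fin finite_subset by blast
    then have fR: "finite (R \<union> star v q T)" using fin by (simp add: star_def)
    ultimately have "card (insert v V) \<le> card (R \<union> star v q T) + 1"
      using cut_connected_card[of "insert v V" id "R \<union> star v q T"] wst[OF that(1)] fin(1) by simp
    moreover have "card (R \<union> star v q T) \<le> card R + card (star v q T)" by (rule card_Un_le)
    moreover have "card (star v q T) \<le> card T"
      unfolding star_def using \<open>finite T\<close> by (rule card_image_le)
    ultimately show False using that(2) cV n by simp
  qed
  define A1 where "A1 = Sigma (pairs S)
    (\<lambda>p. tree_stars V v q (n + 1) (insert (join q p) R) (S - p))"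
  \<comment> \<open>The condition on \<open>a\<close> says that \<open>b\<close> cannot replace
    \<open>a\<close> in \<open>T\<close>, that is, \<open>a\<close> and \<open>b\<close> are
    attached to different components.\<close>
  define A2 where "A2 = Sigma (tree_stars V v q n R S)
    (\<lambda>T. Sigma (S - T) (\<lambda>b. {a \<in> T. \<not> ?con (insert b (T - {a}))}))"
  have "bij_betw (\<lambda>(T, b, a). ({a, b}, T - {a})) A2 A1"
  proof (rule bij_betw_imageI)
    show "inj_on (\<lambda>(T, b, a). ({a, b}, T - {a})) A2"
    proof (rule inj_onI)
      fix x y assume xy: "x \<in> A2" "y \<in> A2"
        and eq: "(\<lambda>(T, b, a). ({a, b}, T - {a})) x = (\<lambda>(T, b, a). ({a, b}, T - {a})) y"
      obtain T b a where x: "x = (T, b, a)" by (cases x)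
      obtain T' b' a' where y: "y = (T', b', a')" by (cases y)
      have h: "?con T" "b \<in> S - T" "a \<in> T" "\<not> ?con (insert b (T - {a}))"
        using xy(1) unfolding x A2_def by (auto simp: TS)
      have h': "?con T'" "b' \<in> S - T'" "a' \<in> T'"
        using xy(2) unfolding y A2_def by (auto simp: TS)
      have e: "{a, b} = {a', b'}" "T - {a} = T' - {a'}" using eq by (auto simp: x y)
      show "x = y"
      proof (cases "a = a'")
        case True
        then have "b = b'" using e by (auto simp: doubleton_eq_iff)
        moreover have "T = T'" using e(2) h(3) h'(3) True by blast
        ultimately show ?thesis using True x y by simp
      next
        \<comment> \<open>If \<open>a\<close> and \<open>b\<close> exchanged roles,
          \<open>T'\<close> would arise from \<open>T\<close> by replacing \<open>a\<close> with
          \<open>b\<close>, which \<open>A2\<close> excludes.\<close>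
        case False
        then have "a = b'" "b = a'" using e by (auto simp: doubleton_eq_iff)
        then have "T' = insert b (T - {a})" using e(2) h'(3) by blast
        then show ?thesis using h(4) h'(1) by simp
      qed
    qed
    show "(\<lambda>(T, b, a). ({a, b}, T - {a})) ` A2 = A1"
    proof (intro equalityI subsetI)
      fix z assume "z \<in> (\<lambda>(T, b, a). ({a, b}, T - {a})) ` A2"
      then obtain T b a where z: "z = ({a, b}, T - {a})" and "(T, b, a) \<in> A2" by auto
      then have T: "T \<subseteq> S" "card T = d" "?con T" "b \<in> S" "b \<notin> T" "a \<in> T"
        and nc: "\<not> ?con (insert b (T - {a}))"
        by (auto simp: A2_def TS)
      have c: "card (T - {a}) + 1 = d"
        using T finite_subset[OF T(1) fin(2)] card_Suc_Diff1[of T a] by simp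
      have aT: "insert a (T - {a}) = T" using T by blast
      have "cut_connected (insert v V) (insert (Upair v (q a)) (R \<union> star v q (T - {a})))"
        using T(3) star_insert[of v q a "T - {a}"] unfolding aT by simp
      moreover have "\<not> cut_connected (insert v V) (insert (Upair v (q b)) (R \<union> star v q (T - {a})))"
        using nc by simp
      moreover have "\<not> ?con (T - {a})" using ncon[of "T - {a}"] T(1) c by auto
      moreover have "within (insert v V) (R \<union> star v q (T - {a}))"
        using wst[of "T - {a}"] T(1) by blast
      moreover have "q a \<in> insert v V" "q b \<in> insert v V" using T q by auto
      ultimately have "cut_connected (insert v V)
          (insert (Upair (q a) (q b)) (R \<union> star v q (T - {a})))"
        using cut_connected_triangle[of "insert v V" "R \<union> star v q (T - {a})" v "q a" "q b"] by simp
      moreover have "a \<noteq> b" using T by blast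
      ultimately show "z \<in> A1"
        using T c TS'[of a b "T - {a}"] by (auto simp: A1_def z pairs_def)
    next
      fix z assume "z \<in> A1"
      then obtain p T where z: "z = (p, T)" and p: "p \<in> pairs S"
        and T: "T \<in> tree_stars V v q (n + 1) (insert (join q p) R) (S - p)"
        by (auto simp: A1_def)
      obtain a b where ab: "p = {a, b}" "a \<noteq> b" "a \<in> S" "b \<in> S" using pairs_doubleton[OF p] .
      have T': "T \<subseteq> S - {a, b}" "card T + 1 = d"
        "cut_connected (insert v V) (insert (Upair (q a) (q b)) (R \<union> star v q T))"
        using T TS'[OF ab(2)] by (auto simp: ab(1))
      have finT: "finite T" using T'(1) fin(2) by (meson finite_Diff finite_subset)
      have sym: "Upair (q a) v = Upair v (q a)" "Upair (q b) v = Upair v (q b)" by simp_all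
      have sub: "T \<subseteq> S" using T'(1) by blast
      \<comment> \<open>\<open>T\<close> alone does not connect, but does so together with the edge
        between \<open>q a\<close> and \<open>q b\<close>. Hence exactly one of \<open>a\<close> and
        \<open>b\<close> completes \<open>T\<close> to a transversal; that one takes the role of
        \<open>a\<close> in \<open>A2\<close>.\<close>
      have iff: "?con (insert a T) \<longleftrightarrow> \<not> ?con (insert b T)"
        using cut_connected_triangle[of "insert v V" "R \<union> star v q T" "q a" "q b" v] T'(3)
          ncon[OF sub] T'(2) wst[OF sub] ab q by (auto simp: sym)
      have mem: "(insert x T, y, x) \<in> A2" if "{x, y} = {a, b}" "x \<noteq> y" "?con (insert x T)" "\<not> ?con (insert y T)" for x y
      proof -
        have "x \<in> S" "y \<in> S" "x \<notin> T" "y \<notin> T" using that(1) ab T'(1) by auto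
        moreover have "insert x T - {x} = T" using \<open>x \<notin> T\<close> by blast
        ultimately show ?thesis
          using that T'(2) finT sub by (auto simp: A2_def TS)
      qed
      have "\<exists>x y. {x, y} = {a, b} \<and> x \<noteq> y \<and> ?con (insert x T) \<and> \<not> ?con (insert y T)"
        using iff ab(2) by (metis insert_commute)
      then obtain x y where xy: "{x, y} = {a, b}" "x \<noteq> y" "?con (insert x T)" "\<not> ?con (insert y T)"
        by blast
      have "x \<notin> T" using xy(1) T'(1) by blast
      then have "z = (\<lambda>(T, b, a). ({a, b}, T - {a})) (insert x T, y, x)"
        using xy(1) z ab(1) by simp
      then show "z \<in> (\<lambda>(T, b, a). ({a, b}, T - {a})) ` A2" using mem[OF xy] by blast
    qed
  qed
  then have "card A1 = card A2" by (rule bij_betw_same_card[symmetric])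
  also have "card A2 = (\<Sum>T\<in>tree_stars V v q n R S. \<Sum>b\<in>S - T. card {a \<in> T. \<not> ?con (insert b (T - {a}))})"
  proof -
    define Z where "Z = (\<lambda>T b. {a \<in> T. \<not> ?con (insert b (T - {a}))})"
    have Z: "finite (Z T b)" if "T \<in> tree_stars V v q n R S" for T b
      using that finite_subset[OF _ fin(2)] by (auto simp: Z_def TS)
    have "card (Sigma (tree_stars V v q n R S) (\<lambda>T. Sigma (S - T) (Z T))) =
        (\<Sum>T\<in>tree_stars V v q n R S. card (Sigma (S - T) (Z T)))"
      using finite_tree_stars[OF fin(2)] Z fin(2) by (intro card_SigmaI) simp_all
    also have "\<dots> = (\<Sum>T\<in>tree_stars V v q n R S. \<Sum>b\<in>S - T. card (Z T b))"
      using Z fin(2) by (intro sum.cong[OF refl] card_SigmaI) simp_all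
    finally show ?thesis unfolding Z_def A2_def .
  qed
  also have "\<dots> = (\<Sum>T\<in>tree_stars V v q n R S. (card S - d) * (d - 1))"
  proof (rule sum.cong[OF refl])
    fix T assume "T \<in> tree_stars V v q n R S"
    then have T: "T \<subseteq> S" "card T = d" "?con T" by (auto simp: TS)
    have finT: "finite T" using T(1) fin(2) by (rule finite_subset)
    \<comment> \<open>Exactly one element of \<open>T\<close> can be replaced by \<open>b\<close>;
      the other \<open>d - 1\<close> are admissible.\<close>
    have "card {a \<in> T. \<not> ?con (insert b (T - {a}))} = d - 1" if b: "b \<in> S - T" for b
    proof -
      have "\<exists>!a. a \<in> T \<and> ?con (insert b (T - {a}))"
        using unique_exchangeable_star_edge[of V R v q T "q b"] w fin v q T b n finT
        by (auto simp: star_def)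
      then obtain a where a: "{a \<in> T. ?con (insert b (T - {a}))} = {a}" by auto
      have "{a \<in> T. \<not> ?con (insert b (T - {a}))} = T - {a \<in> T. ?con (insert b (T - {a}))}" by blast
      also have "card \<dots> = d - 1"
      proof -
        have "a \<in> T" using a by blast
        then show ?thesis unfolding a using T(2) finT by simp
      qed
      finally show ?thesis .
    qed
    then have "(\<Sum>b\<in>S - T. card {a \<in> T. \<not> ?con (insert b (T - {a}))}) = card (S - T) * (d - 1)"
      by simp
    then show "(\<Sum>b\<in>S - T. card {a \<in> T. \<not> ?con (insert b (T - {a}))}) = (card S - d) * (d - 1)"
      using T finT by (simp add: card_Diff_subset)
  qed
  also have "\<dots> = card (tree_stars V v q n R S) * ((card S - d) * (d - 1))" by simp
  finally show ?thesis
    unfolding A1_def using fin(2) by (subst (asm) card_SigmaI) (auto intro: finite_pairs finite_tree_stars)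
qed

text \<open>With \<open>d = j + 2\<close> components the factor is \<open>(d - 2)!\<close>. It
  agrees with the degree-refined Cayley formula: \<open>(d - 2)!\<close> divided by the product of
  all \<open>(deg - 1)!\<close> counts the trees, and the product of all \<open>deg!\<close> counts
  the assignments of half-edges. The induction distinguishes one new edge, joins it first and
  divides by the number of new edges.\<close>

lemma card_tree_pairings:
  assumes "finite V" "finite S" "finite R" "within V R" "v \<notin> V" "q ` S \<subseteq> V" "card R \<le> n"
    and "card S = 2 * Suc j" "n + Suc (Suc j) = card V"
  shows "card (tree_pairings V q n R S) = fact j * card (tree_stars V v q n R S)"
  using assms
proof (induction j arbitrary: n R S)
  \<comment> \<open>There is a single new edge; subdividing it by \<open>v\<close> gives the
    star.\<close>
  case 0
  then obtain a b where S: "S = {a, b}" "a \<noteq> b" by (auto simp: card_2_iff)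
  have "card (insert v V) = n + 3" using 0 by simp
  then have stars: "tree_stars V v q n R S = (if cut_connected (insert v V) (R \<union> star v q S) then {S} else {})"
  proof -
    have "T = S" if "T \<subseteq> S" "card T = card S" for T
      using card_subset_eq[OF \<open>finite S\<close>] that by blast
    then show ?thesis
      using \<open>card (insert v V) = n + 3\<close> 0(8) by (auto simp: tree_stars_def spans_def)
  qed
  have "pairings {a, b} = {{{a, b}}}"
  proof -
    have "{{a, b}} \<in> pairings {a, b}" using S by (simp add: pairings_iff)
    moreover have "\<mu> = {{a, b}}" if \<mu>: "\<mu> \<in> pairings {a, b}" for \<mu>
    proof -
      have p: "p = {a, b}" if "p \<in> \<mu>" for p
        using pairings_pairs[OF \<mu> that] S by (auto simp: pairs_def card_2_iff doubleton_eq_iff)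
      have "\<mu> \<noteq> {}" using pairings_Union[OF \<mu>] by blast
      then show ?thesis using p by blast
    qed
    ultimately show ?thesis by blast
  qed
  then have pair: "tree_pairings V q n R S = (if cut_connected V (insert (Upair (q a) (q b)) R) then {{S}} else {})"
    using 0(9) by (auto simp: tree_pairings_def spans_def S join_eq)
  have "R \<union> star v q S = insert (Upair v (q a)) (insert (Upair v (q b)) R)"
    by (auto simp: S star_def)
  then have "cut_connected (insert v V) (R \<union> star v q S) \<longleftrightarrow> cut_connected V (insert (Upair (q a) (q b)) R)"
    using cut_connected_subdivide[of V R v "q a" "q b"] 0(4-6) S by simp
  then show ?case using stars pair by simp
next
  case (Suc j)
  note IH = Suc.IH and as = Suc.prems
  let ?W = "\<lambda>n R S. card (tree_pairings V q n R S)"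
  have "(Suc (Suc j)) * ?W n R S =
      (\<Sum>\<mu>\<in>pairings S. \<Sum>p\<in>\<mu>. of_bool (spans V (n + card \<mu>) (R \<union> join q ` \<mu>)))"
  proof -
    have c: "card \<mu> = Suc (Suc j)" if "\<mu> \<in> pairings S" for \<mu>
      using card_pairings[OF that \<open>finite S\<close>] as(8) by simp
    have "(\<Sum>\<mu>\<in>pairings S. \<Sum>p\<in>\<mu>. of_bool (spans V (n + card \<mu>) (R \<union> join q ` \<mu>))) =
        (\<Sum>\<mu>\<in>pairings S. Suc (Suc j) * of_bool (spans V (n + card \<mu>) (R \<union> join q ` \<mu>)))"
      by (intro sum.cong[OF refl]) (simp add: c)
    also have "\<dots> = (Suc (Suc j)) * ?W n R S"
      using finite_pairings[OF \<open>finite S\<close>]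
      by (simp only: sum_distrib_left[symmetric])
        (simp add: tree_pairings_def Int_def of_bool_def sum.If_cases)
    finally show ?thesis ..
  qed
  also have "\<dots> = (\<Sum>p\<in>pairs S. \<Sum>\<mu>\<in>pairings (S - p).
      of_bool (spans V (n + card (insert p \<mu>)) (R \<union> join q ` (insert p \<mu>))))"
    using \<open>finite S\<close> by (rule sum_pairings_pick)
  also have "\<dots> = (\<Sum>p\<in>pairs S. ?W (n + 1) (insert (join q p) R) (S - p))"
  proof (rule sum.cong[OF refl])
    fix p assume p: "p \<in> pairs S"
    have "spans V (n + card (insert p \<mu>)) (R \<union> join q ` (insert p \<mu>)) \<longleftrightarrow>
        spans V (n + 1 + card \<mu>) (insert (join q p) R \<union> join q ` \<mu>)"
      if "\<mu> \<in> pairings (S - p)" for \<mu>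
      using pairings_insert(2)[OF p that] pairings_finite[OF that] \<open>finite S\<close> by simp
    then have "(\<Sum>\<mu>\<in>pairings (S - p). of_bool (spans V (n + card (insert p \<mu>)) (R \<union> join q ` (insert p \<mu>)))) =
       (\<Sum>\<mu>\<in>pairings (S - p). of_bool (spans V (n + 1 + card \<mu>) (insert (join q p) R \<union> join q ` \<mu>)))"
      by (intro sum.cong) simp_all
    also have "\<dots> = ?W (n + 1) (insert (join q p) R) (S - p)"
      using finite_pairings[of "S - p"] \<open>finite S\<close>
      by (simp add: tree_pairings_def Int_def of_bool_def sum.If_cases)
    finally show "(\<Sum>\<mu>\<in>pairings (S - p). of_bool (spans V (n + card (insert p \<mu>)) (R \<union> join q ` (insert p \<mu>)))) =
      ?W (n + 1) (insert (join q p) R) (S - p)" .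
  qed
  also have "\<dots> = (\<Sum>p\<in>pairs S. fact j * card (tree_stars V v q (n + 1) (insert (join q p) R) (S - p)))"
  proof (rule sum.cong[OF refl])
    fix p assume p: "p \<in> pairs S"
    obtain a b where ab: "p = {a, b}" "a \<noteq> b" "a \<in> S" "b \<in> S" using pairs_doubleton[OF p] .
    show "?W (n + 1) (insert (join q p) R) (S - p) =
        fact j * card (tree_stars V v q (n + 1) (insert (join q p) R) (S - p))"
    proof (rule IH)
      show "within V (insert (join q p) R)" using as ab by (auto simp: join_eq)
      show "card (insert (join q p) R) \<le> n + 1" using as card_insert_le_m1 by (simp add: card_insert_if)
      show "card (S - p) = 2 * Suc j" using as ab by (simp add: card_Diff_subset)
    qed (use as in auto)
  qed
  also have "\<dots> = fact j * (\<Sum>p\<in>pairs S. card (tree_stars V v q (n + 1) (insert (join q p) R) (S - p)))"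
    by (rule sum_distrib_left[symmetric])
  \<comment> \<open>Here \<open>d = j + 3\<close> and \<open>card S = 2 * j + 4\<close>, so that
    \<open>card S - d = j + 1\<close> and \<open>d - 1 = j + 2\<close>; the second factor cancels
    against the number of new edges.\<close>
  also have "(\<Sum>p\<in>pairs S. card (tree_stars V v q (n + 1) (insert (join q p) R) (S - p))) =
      card (tree_stars V v q n R S) * (Suc j * Suc (Suc j))"
    using sum_tree_stars_pick[of V S R v q n "Suc (Suc (Suc j))"] as by simp
  finally have "Suc (Suc j) * ?W n R S = Suc (Suc j) * (fact (Suc j) * card (tree_stars V v q n R S))"
    by (simp add: algebra_simps)
  then show ?case using mult_cancel1 by blast
qed

section \<open>Convolution of set functions\<close>

definition conv :: "('e set \<Rightarrow> nat) \<Rightarrow> ('e set \<Rightarrow> nat) \<Rightarrow> 'e set \<Rightarrow> nat" where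
  "conv f g S = (\<Sum>A\<in>Pow S. f A * g (S - A))"

text \<open>On finite sets, the \<open>n\<close>-th convolution power of \<open>level 1\<close>,
  with \<open>level 0\<close> as the unit; it counts the orderings of a set of size
  \<open>n\<close>.\<close>

definition level :: "nat \<Rightarrow> 'e set \<Rightarrow> nat" where
  "level n S = (if card S = n then fact n else 0)"

lemma conv_cong:
  assumes "\<And>A. A \<subseteq> S \<Longrightarrow> f A = f' A" "\<And>A. A \<subseteq> S \<Longrightarrow> g A = g' A"
  shows "conv f g S = conv f' g' S"
  unfolding conv_def using assms by (intro sum.cong) auto

lemma conv_commute: "conv f g S = conv g f S"
  unfolding conv_def
  by (rule sum.reindex_bij_witness[where i = "\<lambda>A. S - A" and j = "\<lambda>A. S - A"])
    (auto simp: double_diff mult.commute)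

lemma conv_assoc:
  assumes "finite S"
  shows "conv (conv f g) h S = conv f (conv g h) S"
proof -
  have "conv (conv f g) h S = (\<Sum>B\<in>Pow S. \<Sum>A\<in>Pow B. f A * g (B - A) * h (S - B))"
    by (simp add: conv_def sum_distrib_right)
  also have "\<dots> = (\<Sum>(B, A)\<in>Sigma (Pow S) Pow. f A * g (B - A) * h (S - B))"
    using assms by (intro sum.Sigma) (auto dest: finite_subset)
  also have "\<dots> = (\<Sum>(A, C)\<in>Sigma (Pow S) (\<lambda>A. Pow (S - A)). f A * (g C * h (S - A - C)))"
    by (rule sum.reindex_bij_witness[where i = "\<lambda>(A, C). (A \<union> C, A)" and j = "\<lambda>(B, A). (A, B - A)"])
      (auto simp: mult.assoc Diff_eq Int_assoc intro!: arg_cong[where f = h] arg_cong[where f = g])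
  also have "\<dots> = (\<Sum>A\<in>Pow S. \<Sum>C\<in>Pow (S - A). f A * (g C * h (S - A - C)))"
    using assms by (intro sum.Sigma[symmetric]) auto
  also have "\<dots> = conv f (conv g h) S"
    by (simp add: conv_def sum_distrib_left)
  finally show ?thesis .
qed

lemma conv_level_0:
  assumes "finite S"
  shows "conv f (level 0) S = f S"
proof -
  have "conv f (level 0) S = (\<Sum>A\<in>Pow S. if A = S then f S else 0)"
    unfolding conv_def
  proof (rule sum.cong[OF refl])
    fix A assume "A \<in> Pow S"
    then have "card (S - A) = 0 \<longleftrightarrow> A = S" using assms by auto
    then show "f A * level 0 (S - A) = (if A = S then f S else 0)" by (auto simp: level_def)
  qed
  then show ?thesis using assms by simp
qed

text \<open>There are \<open>(m + n)! / (m! * n!)\<close> ways to choose the first part, and each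
  contributes \<open>m! * n!\<close>.\<close>

lemma conv_level_level:
  assumes "finite S"
  shows "conv (level m) (level n) S = level (m + n) S"
proof -
  have "conv (level m) (level n) S =
      (\<Sum>A\<in>Pow S. if card A = m \<and> card S = m + n then fact m * fact n else 0)"
    unfolding conv_def
  proof (rule sum.cong[OF refl])
    fix A assume "A \<in> Pow S"
    then have "card (S - A) = card S - card A" "card A \<le> card S"
      using assms finite_subset[of A S] by (simp_all add: card_Diff_subset card_mono)
    then show "level m A * level n (S - A) = (if card A = m \<and> card S = m + n then fact m * fact n else 0)"
      by (auto simp: level_def)
  qed
  also have "\<dots> = (if card S = m + n then (\<Sum>A\<in>{A. A \<subseteq> S \<and> card A = m}. fact m * fact n) else 0)"
  proof (cases "card S = m + n")
    case True
    have "(\<Sum>A\<in>Pow S. if card A = m then fact m * fact n else 0) =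
        (\<Sum>A\<in>{A. A \<subseteq> S \<and> card A = m}. fact m * fact n :: nat)"
      using assms by (intro sum.mono_neutral_cong_right) auto
    then show ?thesis using True by simp
  qed simp
  also have "\<dots> = level (m + n) S"
    using assms binomial_fact_lemma[of m "m + n"]
    by (simp add: level_def n_subsets mult.commute)
  finally show ?thesis .
qed

lemma conv_zero: "conv (\<lambda>_. 0) g S = 0"
  by (simp add: conv_def)

lemma conv_interchange:
  assumes "finite S"
  shows "conv (conv f g) (conv f' g') S = conv (conv f f') (conv g g') S"
proof -
  have fin: "finite A" if "A \<subseteq> S" for A using that assms by (rule finite_subset)
  have "conv (conv f g) (conv f' g') S = conv f (conv g (conv f' g')) S"
    using assms by (rule conv_assoc)
  also have "\<dots> = conv f (conv (conv f' g') g) S"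
    by (intro conv_cong refl conv_commute)
  also have "\<dots> = conv f (conv f' (conv g' g)) S"
    by (intro conv_cong refl conv_assoc fin)
  also have "\<dots> = conv (conv f f') (conv g' g) S"
    using assms by (rule conv_assoc[symmetric])
  also have "\<dots> = conv (conv f f') (conv g g') S"
    by (intro conv_cong refl conv_commute)
  finally show ?thesis .
qed

text \<open>Convolution with \<open>level 1\<close> removes one element in all possible ways; it
  will model the choice of a partner.\<close>

lemma conv_level_1:
  assumes "finite S"
  shows "conv f (level 1) S = (\<Sum>a\<in>S. f (S - {a}))"
proof -
  have "conv f (level 1) S = conv (level 1) f S" by (rule conv_commute)
  also have "\<dots> = (\<Sum>A\<in>(\<lambda>a. {a}) ` S. f (S - A))"
    unfolding conv_def using assms
    by (intro sum.mono_neutral_cong_right) (auto simp: level_def card_1_singleton_iff)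
  also have "\<dots> = (\<Sum>a\<in>S. f (S - {a}))" by (subst sum.reindex) auto
  finally show ?thesis .
qed

section \<open>Iterated convolution and common factors\<close>

fun convs :: "(nat \<Rightarrow> 'e set \<Rightarrow> nat) \<Rightarrow> nat \<Rightarrow> 'e set \<Rightarrow> nat" where
  "convs h 0 = level 0"
| "convs h (Suc k) = conv (convs h k) (h k)"

lemma convs_level_1: "finite S \<Longrightarrow> convs (\<lambda>i. level 1) k S = level k S"
proof (induction k arbitrary: S)
  case (Suc k)
  have "convs (\<lambda>i. level 1) (Suc k) S = conv (level k) (level 1) S"
    using Suc by (auto intro!: conv_cong dest: finite_subset)
  then show ?case using Suc.prems by (simp add: conv_level_level)
qed simp

text \<open>With \<open>d\<^sub>i = N - n\<^sub>i\<close> the numerical condition reads \<open>r - p = (\<Sum>i<k. d\<^sub>i - 2)\<close>, written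
  without subtraction.\<close>

lemma convs_common_factor:
  assumes "finite D"
    and "\<And>i. i < k \<Longrightarrow> \<exists>X p r. r + 2 + n i = p + N \<and>
      (\<forall>S\<subseteq>D. f i S = conv X (level p) S \<and> g i S = conv X (level r) S)"
  shows "\<exists>X p r. r + 2 * k + (\<Sum>i<k. n i) = p + k * N \<and>
    (\<forall>S\<subseteq>D. convs f k S = conv X (level p) S \<and> convs g k S = conv X (level r) S)"
  using assms(2)
proof (induction k)
  case 0
  have "\<forall>S\<subseteq>D. level 0 S = conv (level 0) (level 0) S"
    using conv_level_0 finite_subset[OF _ assms(1)] by metis
  then show ?case by (intro exI[of _ "level 0"] exI[of _ 0]) simp
next
  case (Suc k)
  obtain X p r where X: "r + 2 * k + (\<Sum>i<k. n i) = p + k * N \<and>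
    (\<forall>S\<subseteq>D. convs f k S = conv X (level p) S \<and> convs g k S = conv X (level r) S)"
    using Suc.IH[OF Suc.prems[OF less_SucI], simplified] by (elim exE) (rule that)
  obtain Y p' r' where Y: "r' + 2 + n k = p' + N \<and>
    (\<forall>S\<subseteq>D. f k S = conv Y (level p') S \<and> g k S = conv Y (level r') S)"
    using Suc.prems[OF lessI] by (elim exE) (rule that)
  \<comment> \<open>By \<open>conv_interchange\<close>, the factors \<open>X\<close> and
    \<open>Y\<close> and the two \<open>level\<close> factors are collected separately.\<close>
  have merge: "conv F G S = conv (conv X Y) (level (p + p')) S"
    if "S \<subseteq> D" "\<And>S. S \<subseteq> D \<Longrightarrow> F S = conv X (level p) S" "\<And>S. S \<subseteq> D \<Longrightarrow> G S = conv Y (level p') S"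
    for F G p p' S
  proof -
    have fin: "finite A" if "A \<subseteq> S" for A
      by (rule finite_subset[OF subset_trans[OF that \<open>S \<subseteq> D\<close>] assms(1)])
    have "conv F G S = conv (conv X (level p)) (conv Y (level p')) S"
      using that by (intro conv_cong) auto
    also have "\<dots> = conv (conv X Y) (conv (level p) (level p')) S"
      using fin[of S] by (intro conv_interchange) auto
    also have "\<dots> = conv (conv X Y) (level (p + p')) S"
      by (intro conv_cong refl conv_level_level fin)
    finally show ?thesis .
  qed
  show ?case
  proof (intro exI conjI allI impI)
    show "(r + r') + 2 * Suc k + (\<Sum>i<Suc k. n i) = (p + p') + Suc k * N"
      using X Y by simp
    show "convs f (Suc k) S = conv (conv X Y) (level (p + p')) S" if "S \<subseteq> D" for S
      using merge[OF that, of "convs f k" p "f k" p'] X Y by simp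
    show "convs g (Suc k) S = conv (conv X Y) (level (r + r')) S" if "S \<subseteq> D" for S
      using merge[OF that, of "convs g k" r "g k" r'] X Y by simp
  qed
qed

text \<open>Let \<open>d = card V - n\<close>. If \<open>d \<ge> 2\<close>, a tree pairing needs
  \<open>card S = 2 * (d - 1)\<close>, and a transversal with its \<open>d\<close> elements leaves
  \<open>d - 2\<close> over; so the factor \<open>(d - 2)!\<close> of
  \<open>card_tree_pairings\<close> is a convolution with \<open>level (d - 2)\<close>. The
  difference \<open>r - p\<close> is always \<open>d - 2\<close>; two exponents are used because it
  can be negative.\<close>

lemma pair_star_common_factor:
  fixes V :: "'v set" and D :: "'e set"
  assumes V: "finite V" "V \<noteq> {}" and R: "finite R" "within V R" "card R \<le> n"
    and v: "v \<notin> V" and D: "finite D" "q ` D \<subseteq> V"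
  shows "\<exists>X p r. r + 2 + n = p + card V \<and>
    (\<forall>S\<subseteq>D. of_bool (spans (insert v V) (n + card S) (R \<union> star v q S)) = conv X (level p) S \<and>
       card (tree_pairings V q n R S) = conv X (level r) S)"
proof -
  let ?star = "\<lambda>S. of_bool (spans (insert v V) (n + card S) (R \<union> star v q S)) :: nat"
  let ?pair = "\<lambda>S. card (tree_pairings V q n R S)"
  have cV: "card (insert v V) = Suc (card V)" using V v by simp
  have finS: "finite S" if "S \<subseteq> D" for S using that D(1) by (rule finite_subset)
  consider "card V \<le> n" | "card V = n + 1" | j where "card V = n + Suc (Suc j)"
    using less_natE[of "n + 1" "card V"] by fastforce
  then show ?thesis
  proof cases
    \<comment> \<open>There are too many edges for a forest. Both functions vanish, so
      \<open>X\<close> is zero and the exponents are chosen only to meet the numerical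
      condition.\<close>
    case 1
    have "\<not> spans (insert v V) (n + card S) (R \<union> star v q S)" if "S \<subseteq> D" for S
    proof
      assume "spans (insert v V) (n + card S) (R \<union> star v q S)"
      then have "card S = 0" and con: "cut_connected (insert v V) (R \<union> star v q S)"
        using 1 cV by (auto simp: spans_def)
      then have "S = {}" using finS[OF that] by simp
      then have "cut_connected (insert v V) R" using con by (simp add: star_def)
      then obtain u where u: "u \<in> R" "crosses V u"
        using V v unfolding cut_connected_def by (metis insertI1 subset_insertI)
      have "set_uprod u \<subseteq> V" using u(1) R(2) by (auto simp: within_def)
      then show False using u(2) by (cases u) auto
    qed
    moreover have "tree_pairings V q n R S = {}" for S
      using 1 by (auto simp: tree_pairings_def spans_def)
    ultimately show ?thesis
      by (intro exI[of _ "\<lambda>_. 0"] exI[of _ "n + 2"] exI[of _ "card V"]) (simp add: conv_zero)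
  next
    \<comment> \<open>\<open>R\<close> must already be a tree: exactly one half-edge attaches
      \<open>v\<close>, while no pair may be added. Hence \<open>p = 1\<close> and
      \<open>r = 0\<close>.\<close>
    case 2
    define X where "X = (\<lambda>S :: 'e set. of_bool (cut_connected V R) * level 0 S :: nat)"
    have X: "conv X (level m) S = of_bool (cut_connected V R) * level m S" if "S \<subseteq> D" for m S
    proof -
      have "conv X (level m) S = of_bool (cut_connected V R) * conv (level 0) (level m) S"
        by (simp add: conv_def X_def sum_distrib_left)
      then show ?thesis using finS[OF that] by (simp add: conv_level_level)
    qed
    have "?star S = conv X (level 1) S" if S: "S \<subseteq> D" for S
    proof (cases "card S = 1")
      case True
      then obtain a where a: "S = {a}" by (auto simp: card_1_singleton_iff)
      have "cut_connected (insert v V) (R \<union> star v q S) \<longleftrightarrow> cut_connected V R"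
      proof -
        have "q a \<in> V" using D(2) S a by auto
        then show ?thesis using cut_connected_pendant[OF R(2) v, of "q a"] a by (simp add: star_def)
      qed
      then show ?thesis unfolding X[OF S] using True 2 cV by (simp add: spans_def level_def)
    next
      case False
      then show ?thesis unfolding X[OF S] using 2 cV by (simp add: spans_def level_def)
    qed
    moreover have "?pair S = conv X (level 0) S" if S: "S \<subseteq> D" for S
    proof -
      have "tree_pairings V q n R S = (if S = {} \<and> cut_connected V R then {{}} else {})"
      proof -
        have "\<mu> = {}" if "\<mu> \<in> tree_pairings V q n R S" for \<mu>
          using that 2 pairings_finite[of \<mu> S] finS[OF S] by (auto simp: tree_pairings_def spans_def)
        moreover have "{} \<in> pairings S \<longleftrightarrow> S = {}" by (auto simp: pairings_iff)
        ultimately show ?thesis using 2 by (auto simp: tree_pairings_def spans_def)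
      qed
      then show ?thesis unfolding X[OF S] using finS[OF S] by (simp add: level_def)
    qed
    ultimately show ?thesis
      using 2 by (intro exI[of _ X] exI[of _ 1] exI[of _ 0]) auto
  next
    case (3 j)
    have "?star S = conv ?star (level 0) S" if "S \<subseteq> D" for S
      using finS[OF that] by (simp only: conv_level_0)
    moreover have "?pair S = conv ?star (level j) S" if S: "S \<subseteq> D" for S
    proof -
      have cT: "card T = j + 2" if "spans (insert v V) (n + card T) (R \<union> star v q T)" for T
        using that 3 cV by (simp add: spans_def)
      have cS: "card (S - T) = card S - card T" "card T \<le> card S" if "T \<subseteq> S" for T
        using that finS[OF S] finite_subset[OF that] by (simp_all add: card_Diff_subset card_mono)
      show ?thesis
      proof (cases "card S = 2 * Suc j")
        case True
        have "conv ?star (level j) S = (\<Sum>T\<in>tree_stars V v q n R S. fact j)"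
          unfolding conv_def
        proof (intro sum.mono_neutral_cong_right)
          show "finite (Pow S)" using finS[OF S] by simp
          show "tree_stars V v q n R S \<subseteq> Pow S" by (auto simp: tree_stars_def)
          show "\<forall>T\<in>Pow S - tree_stars V v q n R S. ?star T * level j (S - T) = 0"
            by (auto simp: tree_stars_def)
          show "?star T * level j (S - T) = fact j" if "T \<in> tree_stars V v q n R S" for T
            using that cT[of T] cS[of T] True by (simp add: tree_stars_def level_def)
        qed
        also have "\<dots> = ?pair S"
        proof -
          have "q ` S \<subseteq> V" using D(2) S by blast
          then show ?thesis
            using card_tree_pairings[OF V(1) finS[OF S] R(1,2) v _ R(3) True] 3 by simp
        qed
        finally show ?thesis ..
      next
        case False
        have "?star T * level j (S - T) = 0" if "T \<subseteq> S" for T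
          using cT[of T] cS[OF that] False by (auto simp: level_def)
        then have "conv ?star (level j) S = 0"
          unfolding conv_def by (intro sum.neutral ballI) (simp only: Pow_iff)
        moreover have "tree_pairings V q n R S = {}"
          using False 3 card_pairings[OF _ finS[OF S]] by (auto simp: tree_pairings_def spans_def)
        ultimately show ?thesis by simp
      qed
    qed
    ultimately show ?thesis
      using 3 by (intro exI[of _ ?star] exI[of _ 0] exI[of _ j]) auto
  qed
qed

section \<open>Colourings\<close>

text \<open>The condition may depend on the colour: once part of the edges is coloured, each class
  has its own forest to complete.\<close>

definition colourings :: "'a set \<Rightarrow> nat \<Rightarrow> (nat \<Rightarrow> 'a set \<Rightarrow> bool) \<Rightarrow> ('a \<Rightarrow> nat) set" where
  "colourings A k Q = {c \<in> A \<rightarrow>\<^sub>E {..<k}. \<forall>i<k. Q i {a \<in> A. c a = i}}"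

lemma finite_colourings: "finite A \<Longrightarrow> finite (colourings A k Q)"
  unfolding colourings_def by (rule finite_subset[OF _ finite_PiE[of A "\<lambda>_. {..<k}"]]) auto

lemma colourings_cong:
  assumes "\<And>i S. i < k \<Longrightarrow> S \<subseteq> A \<Longrightarrow> Q i S \<longleftrightarrow> Q' i S"
  shows "colourings A k Q = colourings A k Q'"
  unfolding colourings_def using assms by (intro Collect_cong) auto

text \<open>A colouring is an ordered decomposition of \<open>A\<close> into possibly empty classes,
  and an iterated convolution sums over these. The induction splits off the class of the last
  colour.\<close>

lemma card_colourings:
  assumes "finite A"
  shows "card (colourings A k Q) = convs (\<lambda>i S. of_bool (Q i S)) k A"
  using assms
proof (induction k arbitrary: A)
  case 0
  then show ?case by (cases "A = {}") (auto simp: colourings_def level_def PiE_eq_empty_iff)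
next
  case (Suc k)
  have "bij_betw (\<lambda>c. ({a \<in> A. c a < k}, restrict c {a \<in> A. c a < k})) (colourings A (Suc k) Q)
      (Sigma {B. B \<subseteq> A \<and> Q k (A - B)} (\<lambda>B. colourings B k Q))"
  proof (rule bij_betw_byWitness[where f' = "\<lambda>(B, c). \<lambda>a\<in>A. if a \<in> B then c a else k"])
    show "\<forall>c\<in>colourings A (Suc k) Q. (\<lambda>(B, c). \<lambda>a\<in>A. if a \<in> B then c a else k)
        ({a \<in> A. c a < k}, restrict c {a \<in> A. c a < k}) = c"
      by (auto simp: colourings_def fun_eq_iff PiE_def extensional_def less_Suc_eq Pi_def)
    show "\<forall>x\<in>Sigma {B. B \<subseteq> A \<and> Q k (A - B)} (\<lambda>B. colourings B k Q).
        (\<lambda>c. ({a \<in> A. c a < k}, restrict c {a \<in> A. c a < k}))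
          ((\<lambda>(B, c). \<lambda>a\<in>A. if a \<in> B then c a else k) x) = x"
    proof
      fix x assume "x \<in> Sigma {B. B \<subseteq> A \<and> Q k (A - B)} (\<lambda>B. colourings B k Q)"
      then obtain B c where x: "x = (B, c)" "B \<subseteq> A" "c \<in> B \<rightarrow>\<^sub>E {..<k}"
        by (auto simp: colourings_def)
      have "{a \<in> A. (\<lambda>a\<in>A. if a \<in> B then c a else k) a < k} = B"
        using x by (auto simp: PiE_def Pi_def)
      moreover have "restrict (\<lambda>a\<in>A. if a \<in> B then c a else k) B = c"
        using x by (auto simp: PiE_def extensional_def fun_eq_iff)
      ultimately show "(\<lambda>c. ({a \<in> A. c a < k}, restrict c {a \<in> A. c a < k}))
          ((\<lambda>(B, c). \<lambda>a\<in>A. if a \<in> B then c a else k) x) = x"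
        by (simp add: x(1))
    qed
    show "(\<lambda>c. ({a \<in> A. c a < k}, restrict c {a \<in> A. c a < k})) ` colourings A (Suc k) Q
        \<subseteq> Sigma {B. B \<subseteq> A \<and> Q k (A - B)} (\<lambda>B. colourings B k Q)"
    proof
      fix x assume "x \<in> (\<lambda>c. ({a \<in> A. c a < k}, restrict c {a \<in> A. c a < k})) ` colourings A (Suc k) Q"
      then obtain c where c: "c \<in> A \<rightarrow>\<^sub>E {..<Suc k}" "\<And>i. i < Suc k \<Longrightarrow> Q i {a \<in> A. c a = i}"
        and x: "x = ({a \<in> A. c a < k}, restrict c {a \<in> A. c a < k})"
        by (auto simp: colourings_def)
      have "A - {a \<in> A. c a < k} = {a \<in> A. c a = k}"
        using c(1) by (auto simp: PiE_def Pi_def less_Suc_eq)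
      moreover have "{a \<in> {a \<in> A. c a < k}. restrict c {a \<in> A. c a < k} a = i} = {a \<in> A. c a = i}" if "i < k" for i
        using that by auto
      moreover have "restrict c {a \<in> A. c a < k} \<in> {a \<in> A. c a < k} \<rightarrow>\<^sub>E {..<k}" by auto
      ultimately show "x \<in> Sigma {B. B \<subseteq> A \<and> Q k (A - B)} (\<lambda>B. colourings B k Q)"
        using c(2) unfolding x colourings_def by auto
    qed
    show "(\<lambda>(B, c). \<lambda>a\<in>A. if a \<in> B then c a else k) `
        Sigma {B. B \<subseteq> A \<and> Q k (A - B)} (\<lambda>B. colourings B k Q) \<subseteq> colourings A (Suc k) Q"
    proof clarify
      fix B c assume B: "B \<subseteq> A" "Q k (A - B)" "c \<in> colourings B k Q"
      let ?c = "\<lambda>a\<in>A. if a \<in> B then c a else k"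
      have c: "c \<in> B \<rightarrow>\<^sub>E {..<k}" "\<And>i. i < k \<Longrightarrow> Q i {a \<in> B. c a = i}"
        using B(3) by (auto simp: colourings_def)
      have "{a \<in> A. ?c a = k} = A - B" using c(1) B(1) by (auto simp: PiE_def Pi_def)
      moreover have "{a \<in> A. ?c a = i} = {a \<in> B. c a = i}" if "i < k" for i
        using B(1) that by auto
      moreover have "?c \<in> A \<rightarrow>\<^sub>E {..<Suc k}" using c(1) by (auto simp: PiE_def Pi_def less_Suc_eq)
      ultimately show "?c \<in> colourings A (Suc k) Q"
        using c(2) B(2) unfolding colourings_def by (auto simp: less_Suc_eq simp del: restrict_apply)
    qed
  qed
  then have "card (colourings A (Suc k) Q) = card (Sigma {B. B \<subseteq> A \<and> Q k (A - B)} (\<lambda>B. colourings B k Q))"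
    by (rule bij_betw_same_card)
  also have "\<dots> = (\<Sum>B\<in>{B. B \<subseteq> A \<and> Q k (A - B)}. card (colourings B k Q))"
    using Suc.prems by (intro card_SigmaI) (auto intro: finite_colourings finite_subset)
  also have "\<dots> = (\<Sum>B\<in>Pow A. card (colourings B k Q) * of_bool (Q k (A - B)))"
    using Suc.prems by (intro sum.mono_neutral_cong_left) auto
  also have "\<dots> = (\<Sum>B\<in>Pow A. convs (\<lambda>i S. of_bool (Q i S)) k B * of_bool (Q k (A - B)))"
    using Suc.IH Suc.prems by (intro sum.cong) (auto dest: finite_subset)
  finally show ?case by (simp add: conv_def)
qed

text \<open>The colouring \<open>c\<close> of \<open>A\<close> ranges over all functions, its
  classes being absorbed into the conditions on \<open>B\<close>. In this way the colours of the
  edges avoiding \<open>v\<close> and \<open>w\<close> are fixed.\<close>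

lemma card_colourings_Un:
  assumes "finite A" "finite B" "A \<inter> B = {}"
  shows "card (colourings (A \<union> B) k Q) =
    (\<Sum>c\<in>A \<rightarrow>\<^sub>E {..<k}. card (colourings B k (\<lambda>i S. Q i ({a \<in> A. c a = i} \<union> S))))"
proof -
  let ?Q = "\<lambda>c i S. Q i ({a \<in> A. c a = i} \<union> S)"
  have "bij_betw (\<lambda>c. (restrict c A, restrict c B)) (colourings (A \<union> B) k Q)
      (Sigma (A \<rightarrow>\<^sub>E {..<k}) (\<lambda>c. colourings B k (?Q c)))"
  proof (rule bij_betw_byWitness[where f' = "\<lambda>(c, d). \<lambda>a\<in>A \<union> B. if a \<in> A then c a else d a"])
    show "\<forall>c\<in>colourings (A \<union> B) k Q.
        (\<lambda>(c, d). \<lambda>a\<in>A \<union> B. if a \<in> A then c a else d a) (restrict c A, restrict c B) = c"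
      by (auto simp: colourings_def fun_eq_iff PiE_def extensional_def)
    show "\<forall>x\<in>Sigma (A \<rightarrow>\<^sub>E {..<k}) (\<lambda>c. colourings B k (?Q c)).
        (\<lambda>c. (restrict c A, restrict c B)) ((\<lambda>(c, d). \<lambda>a\<in>A \<union> B. if a \<in> A then c a else d a) x) = x"
      using assms(3) by (auto simp: colourings_def fun_eq_iff PiE_def extensional_def)
    show "(\<lambda>c. (restrict c A, restrict c B)) ` colourings (A \<union> B) k Q
        \<subseteq> Sigma (A \<rightarrow>\<^sub>E {..<k}) (\<lambda>c. colourings B k (?Q c))"
    proof clarify
      fix c assume "c \<in> colourings (A \<union> B) k Q"
      then have c: "c \<in> A \<union> B \<rightarrow>\<^sub>E {..<k}" "\<And>i. i < k \<Longrightarrow> Q i {a \<in> A \<union> B. c a = i}"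
        by (auto simp: colourings_def)
      have "{a \<in> A. restrict c A a = i} \<union> {a \<in> B. restrict c B a = i} = {a \<in> A \<union> B. c a = i}" for i
        by auto
      moreover have "restrict c A \<in> A \<rightarrow>\<^sub>E {..<k}" "restrict c B \<in> B \<rightarrow>\<^sub>E {..<k}"
        using c(1) by auto
      ultimately show "restrict c A \<in> A \<rightarrow>\<^sub>E {..<k} \<and> restrict c B \<in> colourings B k (?Q (restrict c A))"
        using c(2) unfolding colourings_def by (simp del: restrict_apply)
    qed
    show "(\<lambda>(c, d). \<lambda>a\<in>A \<union> B. if a \<in> A then c a else d a) `
        Sigma (A \<rightarrow>\<^sub>E {..<k}) (\<lambda>c. colourings B k (?Q c)) \<subseteq> colourings (A \<union> B) k Q"
    proof clarify
      fix c d assume c: "c \<in> A \<rightarrow>\<^sub>E {..<k}" and d: "d \<in> colourings B k (?Q c)"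
      let ?c = "\<lambda>a\<in>A \<union> B. if a \<in> A then c a else d a"
      have "{a \<in> A \<union> B. ?c a = i} = {a \<in> A. c a = i} \<union> {a \<in> B. d a = i}" for i
        using assms(3) by auto
      moreover have "?c \<in> A \<union> B \<rightarrow>\<^sub>E {..<k}"
        using c d unfolding colourings_def by (auto simp: PiE_iff)
      ultimately show "?c \<in> colourings (A \<union> B) k Q"
        using d unfolding colourings_def by (simp del: restrict_apply)
    qed
  qed
  then have "card (colourings (A \<union> B) k Q) = card (Sigma (A \<rightarrow>\<^sub>E {..<k}) (\<lambda>c. colourings B k (?Q c)))"
    by (rule bij_betw_same_card)
  also have "\<dots> = (\<Sum>c\<in>A \<rightarrow>\<^sub>E {..<k}. card (colourings B k (?Q c)))"
    using assms by (intro card_SigmaI) (auto intro: finite_colourings finite_PiE)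
  finally show ?thesis .
qed

text \<open>Serves to pass from the recycled labels of new edges to the pairs themselves.\<close>

lemma card_colourings_image:
  assumes "inj_on h B"
  shows "card (colourings (h ` B) k Q) = card (colourings B k (\<lambda>i S. Q i (h ` S)))"
proof (rule bij_betw_same_card[of "\<lambda>c. restrict (c \<circ> h) B"],
    rule bij_betw_byWitness[where f' = "\<lambda>c. restrict (c \<circ> the_inv_into B h) (h ` B)"])
  show "\<forall>c\<in>colourings (h ` B) k Q. restrict (restrict (c \<circ> h) B \<circ> the_inv_into B h) (h ` B) = c"
    using assms by (auto simp: colourings_def fun_eq_iff PiE_def extensional_def the_inv_into_f_f)
  show "\<forall>c\<in>colourings B k (\<lambda>i S. Q i (h ` S)).
      restrict (restrict (c \<circ> the_inv_into B h) (h ` B) \<circ> h) B = c"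
    using assms by (auto simp: colourings_def fun_eq_iff PiE_def extensional_def the_inv_into_f_f)
  show "(\<lambda>c. restrict (c \<circ> h) B) ` colourings (h ` B) k Q \<subseteq> colourings B k (\<lambda>i S. Q i (h ` S))"
  proof clarify
    fix c assume c: "c \<in> colourings (h ` B) k Q"
    have "h ` {a \<in> B. restrict (c \<circ> h) B a = i} = {a \<in> h ` B. c a = i}" for i by auto
    moreover have "restrict (c \<circ> h) B \<in> B \<rightarrow>\<^sub>E {..<k}"
      using c unfolding colourings_def by auto
    ultimately show "restrict (c \<circ> h) B \<in> colourings B k (\<lambda>i S. Q i (h ` S))"
      using c unfolding colourings_def by (simp del: restrict_apply)
  qed
  show "(\<lambda>c. restrict (c \<circ> the_inv_into B h) (h ` B)) ` colourings B k (\<lambda>i S. Q i (h ` S))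
      \<subseteq> colourings (h ` B) k Q"
  proof clarify
    fix c assume c: "c \<in> colourings B k (\<lambda>i S. Q i (h ` S))"
    let ?c = "restrict (c \<circ> the_inv_into B h) (h ` B)"
    have v: "?c (h b) = c b" if "b \<in> B" for b using that assms by (simp add: the_inv_into_f_f)
    have "{a \<in> h ` B. ?c a = i} = h ` {a \<in> B. c a = i}" for i
      using v by (auto simp del: restrict_apply)
    moreover have "?c \<in> h ` B \<rightarrow>\<^sub>E {..<k}"
      using c v unfolding colourings_def PiE_iff by (auto simp del: restrict_apply)
    ultimately show "?c \<in> colourings (h ` B) k Q"
      using c unfolding colourings_def by (simp del: restrict_apply)
  qed
qed

section \<open>Pairings and convolution\<close>

text \<open>Colouring the pairs of a pairing amounts to distributing the half-edges over the colours
  and pairing them up within each colour.\<close>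

lemma sum_pairings_convs:
  assumes "finite S"
  shows "(\<Sum>\<mu>\<in>pairings S. convs h k \<mu>) = convs (\<lambda>i S. \<Sum>\<mu>\<in>pairings S. h i \<mu>) k S"
  using assms
proof (induction k arbitrary: S)
  case 0
  show ?case
  proof (cases "S = {}")
    case False
    have "level 0 \<mu> = 0" if "\<mu> \<in> pairings S" for \<mu>
      using pairings_Union[OF that] pairings_finite[OF that 0] False by (auto simp: level_def)
    then show ?thesis using False 0 by (simp add: level_def)
  qed (simp add: level_def)
next
  case (Suc k)
  have "(\<Sum>\<mu>\<in>pairings S. convs h (Suc k) \<mu>) =
      (\<Sum>B\<in>Pow S. \<Sum>\<nu>\<in>pairings B. \<Sum>\<mu>\<in>pairings (S - B). convs h k \<nu> * h k \<mu>)"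
    using sum_pairings_split[OF Suc.prems, of "\<lambda>\<nu> \<mu>. convs h k \<nu> * h k \<mu>"] by (simp add: conv_def)
  also have "\<dots> = (\<Sum>B\<in>Pow S. (\<Sum>\<nu>\<in>pairings B. convs h k \<nu>) * (\<Sum>\<mu>\<in>pairings (S - B). h k \<mu>))"
    by (simp add: sum_product)
  also have "\<dots> = (\<Sum>B\<in>Pow S. convs (\<lambda>i S. \<Sum>\<mu>\<in>pairings S. h i \<mu>) k B * (\<Sum>\<mu>\<in>pairings (S - B). h k \<mu>))"
    using Suc.IH Suc.prems by (intro sum.cong) (auto dest: finite_subset)
  finally show ?case by (simp add: conv_def)
qed

text \<open>\<open>C\<close> stands for the edges between \<open>v\<close> and \<open>w\<close>, and
  \<open>D\<close> for the other edges at \<open>v\<close>. If no pair lies inside \<open>C\<close>,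
  its elements have distinct partners in \<open>D\<close>, assigned in \<open>fact (card C)\<close>
  ways for each set of partners, and the rest of \<open>D\<close> is paired within itself. The
  induction removes an element of \<open>C\<close> with its partner.\<close>

lemma sum_pairings_bipartite:
  assumes "finite C" "finite D" "C \<inter> D = {}"
  shows "(\<Sum>\<tau>\<in>pairings (D \<union> C). if \<forall>p\<in>\<tau>. \<not> p \<subseteq> C then \<Phi> {p \<in> \<tau>. p \<subseteq> D} else 0) =
    conv (\<lambda>S. \<Sum>\<mu>\<in>pairings S. \<Phi> \<mu>) (level (card C)) D"
  using assms
proof (induction C arbitrary: D rule: finite_induct)
  case empty
  have "p \<noteq> {} \<and> p \<subseteq> D" if "\<tau> \<in> pairings D" "p \<in> \<tau>" for p \<tau>
    using pairings_pairs[OF that] by (auto simp: pairs_def)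
  then have "{p \<in> \<tau>. p \<subseteq> D} = \<tau>" "\<forall>p\<in>\<tau>. \<not> p \<subseteq> {}" if "\<tau> \<in> pairings D" for \<tau>
    using that by blast+
  then show ?case using empty by (simp add: conv_level_0)
next
  case (insert c C)
  let ?g = "\<lambda>\<tau>. if \<forall>p\<in>\<tau>. \<not> p \<subseteq> insert c C then \<Phi> {p \<in> \<tau>. p \<subseteq> D} else 0"
  let ?X = "\<lambda>S. \<Sum>\<mu>\<in>pairings S. \<Phi> \<mu>"
  have cD: "c \<notin> D" using insert by blast
  have "(\<Sum>\<tau>\<in>pairings (D \<union> insert c C). ?g \<tau>) =
      (\<Sum>a\<in>D \<union> C. \<Sum>\<tau>\<in>pairings (D \<union> C - {a}). ?g (insert {a, c} \<tau>))"
    using insert cD by (subst sum_pairings_insert[symmetric]) auto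
  \<comment> \<open>A partner in \<open>C\<close> would give a pair inside
    \<open>insert c C\<close>, so these terms vanish.\<close>
  also have "\<dots> = (\<Sum>a\<in>D. \<Sum>\<tau>\<in>pairings (D \<union> C - {a}). ?g (insert {a, c} \<tau>))"
    using insert by (intro sum.mono_neutral_right) auto
  also have "\<dots> = (\<Sum>a\<in>D. conv ?X (level (card C)) (D - {a}))"
  proof (rule sum.cong[OF refl])
    fix a assume a: "a \<in> D"
    have eq: "D \<union> C - {a} = (D - {a}) \<union> C" using a insert.prems by blast
    have "?g (insert {a, c} \<tau>) =
        (if \<forall>p\<in>\<tau>. \<not> p \<subseteq> C then \<Phi> {p \<in> \<tau>. p \<subseteq> D - {a}} else 0)"
      if \<tau>: "\<tau> \<in> pairings ((D - {a}) \<union> C)" for \<tau>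
    proof -
      have sub: "p \<subseteq> (D - {a}) \<union> C" if "p \<in> \<tau>" for p
        using pairings_Union[OF \<tau>] that by blast
      have "{p \<in> insert {a, c} \<tau>. p \<subseteq> D} = {p \<in> \<tau>. p \<subseteq> D - {a}}"
      proof -
        have "p \<subseteq> D \<longleftrightarrow> p \<subseteq> D - {a}" if "p \<in> \<tau>" for p
          using sub[OF that] a insert.prems by blast
        then show ?thesis using cD by auto
      qed
      moreover have "(\<forall>p\<in>insert {a, c} \<tau>. \<not> p \<subseteq> insert c C) \<longleftrightarrow> (\<forall>p\<in>\<tau>. \<not> p \<subseteq> C)"
      proof -
        have "p \<subseteq> insert c C \<longleftrightarrow> p \<subseteq> C" if "p \<in> \<tau>" for p
          using sub[OF that] cD insert.hyps by blast
        moreover have "\<not> {a, c} \<subseteq> insert c C" using a insert.prems cD by auto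
        ultimately show ?thesis by auto
      qed
      ultimately show ?thesis by simp
    qed
    then have "(\<Sum>\<tau>\<in>pairings (D \<union> C - {a}). ?g (insert {a, c} \<tau>)) =
        (\<Sum>\<tau>\<in>pairings ((D - {a}) \<union> C). if \<forall>p\<in>\<tau>. \<not> p \<subseteq> C then \<Phi> {p \<in> \<tau>. p \<subseteq> D - {a}} else 0)"
      unfolding eq by (intro sum.cong refl)
    also have "\<dots> = conv ?X (level (card C)) (D - {a})"
      using insert.prems by (intro insert.IH) auto
    finally show "(\<Sum>\<tau>\<in>pairings (D \<union> C - {a}). ?g (insert {a, c} \<tau>)) =
        conv ?X (level (card C)) (D - {a})" .
  qed
  also have "\<dots> = conv (conv ?X (level (card C))) (level 1) D"
    using insert.prems by (intro conv_level_1[symmetric]) auto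
  also have "\<dots> = conv ?X (conv (level (card C)) (level 1)) D"
    using insert.prems by (intro conv_assoc) auto
  also have "\<dots> = conv ?X (level (card (insert c C))) D"
    using insert by (intro conv_cong refl) (simp add: conv_level_level finite_subset)
  finally show ?case .
qed

text \<open>Nonempty colour classes are distinct, so each partition into \<open>k\<close> parts
  arises from exactly its \<open>fact k\<close> numberings.\<close>

lemma card_colourings_partitions:
  assumes "finite E" "\<And>T. Q T \<Longrightarrow> T \<noteq> {}"
  shows "card (colourings E k (\<lambda>_. Q)) =
    fact k * card {P. partition_on E P \<and> card P = k \<and> (\<forall>T\<in>P. Q T)}"
proof -
  let ?fib = "\<lambda>c i. {e \<in> E. c e = i}"
  define Ps where "Ps = {P. partition_on E P \<and> card P = k \<and> (\<forall>T\<in>P. Q T)}"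
  \<comment> \<open>The numberings of the parts: for \<open>P\<close> in \<open>Ps\<close>, an
    injection of the \<open>k\<close> colours into the \<open>k\<close> parts is a
    bijection.\<close>
  define Bs where "Bs = (\<lambda>P. {g \<in> {..<k} \<rightarrow>\<^sub>E P. inj_on g {..<k}} :: (nat \<Rightarrow> 'a set) set)"
  have finP: "finite P" if "P \<in> Ps" for P
  proof -
    have "P \<subseteq> Pow E" using that by (auto simp: Ps_def partition_on_def)
    then show ?thesis using assms(1) by (simp add: finite_subset)
  qed
  have cB: "card (Bs P) = fact k" if "P \<in> Ps" for P
  proof -
    have "card P = k" using that by (simp add: Ps_def)
    then show ?thesis
      using card_inj_on_subset_funcset[of "{..<k}" P "{..<k}"] finP[OF that]
      by (simp add: Bs_def fact_prod_rev)
  qed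
  have im: "g ` {..<k} = P" if "P \<in> Ps" "g \<in> Bs P" for P g
  proof (rule card_subset_eq)
    show "finite P" using finP that(1) .
    show "g ` {..<k} \<subseteq> P" using that(2) by (auto simp: Bs_def)
    show "card (g ` {..<k}) = card P" using that by (simp add: Bs_def Ps_def card_image)
  qed
  have "bij_betw (\<lambda>c. (?fib c ` {..<k}, restrict (?fib c) {..<k})) (colourings E k (\<lambda>_. Q)) (Sigma Ps Bs)"
  proof (rule bij_betw_imageI)
    show "inj_on (\<lambda>c. (?fib c ` {..<k}, restrict (?fib c) {..<k})) (colourings E k (\<lambda>_. Q))"
    proof (rule inj_onI)
      fix c d assume c: "c \<in> colourings E k (\<lambda>_. Q)" and d: "d \<in> colourings E k (\<lambda>_. Q)"
        and "(?fib c ` {..<k}, restrict (?fib c) {..<k}) = (?fib d ` {..<k}, restrict (?fib d) {..<k})"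
      then have eq: "restrict (?fib c) {..<k} = restrict (?fib d) {..<k}" by simp
      have cE: "c \<in> E \<rightarrow>\<^sub>E {..<k}" "d \<in> E \<rightarrow>\<^sub>E {..<k}" using c d by (simp_all add: colourings_def)
      show "c = d"
      proof (rule PiE_ext[OF cE])
        fix e assume e: "e \<in> E"
        then have "c e < k" using cE(1) by auto
        then have "?fib c (c e) = ?fib d (c e)" using fun_cong[OF eq, of "c e"] by simp
        moreover have "e \<in> ?fib c (c e)" using e by simp
        ultimately have "e \<in> ?fib d (c e)" by (rule subst)
        then show "c e = d e" by simp
      qed
    qed
    show "(\<lambda>c. (?fib c ` {..<k}, restrict (?fib c) {..<k})) ` colourings E k (\<lambda>_. Q) = Sigma Ps Bs"
    proof (intro equalityI subsetI)
      fix x assume "x \<in> (\<lambda>c. (?fib c ` {..<k}, restrict (?fib c) {..<k})) ` colourings E k (\<lambda>_. Q)"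
      then obtain c where x: "x = (?fib c ` {..<k}, restrict (?fib c) {..<k})"
        and c: "c \<in> E \<rightarrow>\<^sub>E {..<k}" "\<And>i. i < k \<Longrightarrow> Q (?fib c i)"
        by (auto simp: colourings_def)
      have inj: "inj_on (?fib c) {..<k}"
      proof (rule inj_onI)
        fix i j assume ij: "i \<in> {..<k}" "?fib c i = ?fib c j"
        then obtain e where "e \<in> ?fib c i" using assms(2)[OF c(2)[of i]] by blast
        then show "i = j" using ij(2) by blast
      qed
      have "partition_on E (?fib c ` {..<k})"
        using c assms(2)[OF c(2)] by (intro partition_onI) (auto simp: disjnt_def)
      then have "?fib c ` {..<k} \<in> Ps"
        using c(2) inj by (auto simp: Ps_def card_image)
      moreover have "restrict (?fib c) {..<k} \<in> Bs (?fib c ` {..<k})"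
        using inj by (auto simp: Bs_def)
      ultimately show "x \<in> Sigma Ps Bs" unfolding x by blast
    next
      fix x assume "x \<in> Sigma Ps Bs"
      then obtain P g where x: "x = (P, g)" and P: "P \<in> Ps" and g: "g \<in> Bs P" by blast
      have part: "partition_on E P" using P by (simp add: Ps_def)
      have inj: "inj_on g {..<k}" and ext: "g \<in> {..<k} \<rightarrow>\<^sub>E P" using g by (auto simp: Bs_def)
      have "\<exists>i<k. e \<in> g i" if "e \<in> E" for e
        using that part im[OF P g] by (auto simp: partition_on_def)
      then obtain c0 where c0: "\<And>e. e \<in> E \<Longrightarrow> c0 e < k \<and> e \<in> g (c0 e)" by metis
      define c where "c = restrict c0 E"
      have fib: "?fib c i = g i" if i: "i < k" for i
      proof
        show "?fib c i \<subseteq> g i" using c0 by (auto simp: c_def)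
        have gi: "g i \<in> P" using ext i by auto
        show "g i \<subseteq> ?fib c i"
        proof
          fix e assume e: "e \<in> g i"
          then have eE: "e \<in> E" using gi part by (auto simp: partition_on_def)
          have "g (c0 e) \<in> P" using ext c0[OF eE] by auto
          then have "g (c0 e) = g i"
            using disjointD[OF partition_onD2[OF part] gi, of "g (c0 e)"] e c0[OF eE] by blast
          then have "c0 e = i" using inj c0[OF eE] i by (auto simp: inj_on_def)
          then show "e \<in> ?fib c i" using eE by (simp add: c_def)
        qed
      qed
      have "c \<in> colourings E k (\<lambda>_. Q)"
        using c0 fib ext P by (auto simp: colourings_def c_def Ps_def)
      moreover have "?fib c ` {..<k} = P" using im[OF P g] fib by auto
      moreover have "restrict (?fib c) {..<k} = g"
        using fib ext by (auto simp: fun_eq_iff PiE_def extensional_def)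
      ultimately show "x \<in> (\<lambda>c. (?fib c ` {..<k}, restrict (?fib c) {..<k})) ` colourings E k (\<lambda>_. Q)"
        unfolding x by blast
    qed
  qed
  then have "card (colourings E k (\<lambda>_. Q)) = card (Sigma Ps Bs)" by (rule bij_betw_same_card)
  also have "\<dots> = (\<Sum>P\<in>Ps. card (Bs P))"
  proof (rule card_SigmaI)
    show "finite Ps"
      using assms(1) by (intro finite_subset[of Ps "Pow (Pow E)"]) (auto simp: Ps_def partition_on_def)
    show "\<forall>P\<in>Ps. finite (Bs P)"
      using cB by (metis card_ge_0_finite fact_gt_zero)
  qed
  also have "\<dots> = fact k * card Ps" using cB by simp
  finally show ?thesis unfolding Ps_def .
qed

section \<open>Trees and cuts\<close>

text \<open>Between the positions \<open>i\<close> and \<open>j\<close> the walk has to change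
  sides. The starting position is free so that the first edge of a cycle can be skipped.\<close>

lemma walk_crossing:
  assumes w: "walk G vs es" and "i \<le> j" "j \<le> length es" "vs ! i \<in> U \<longleftrightarrow> vs ! j \<notin> U"
  shows "\<exists>l. i \<le> l \<and> l < j \<and> crosses U (ends G (es ! l))"
proof (rule ccontr)
  assume *: "\<not> ?thesis"
  have "vs ! i \<in> U \<longleftrightarrow> vs ! l \<in> U" if "l \<le> j" "i \<le> l" for l
    using that
  proof (induction l)
    case (Suc l)
    show ?case
    proof (cases "i = Suc l")
      case False
      have "ends G (es ! l) = Upair (vs ! l) (vs ! Suc l)"
        using w Suc.prems assms(3) by (simp add: walk_def)
      moreover have "\<not> crosses U (ends G (es ! l))" using * Suc.prems False by simp
      ultimately show ?thesis using Suc False by simp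
    qed simp
  qed simp
  then show False using assms by blast
qed

lemma cut_connected_distinct_walk:
  assumes G: "multigraph G" and con: "cut_connected (verts G) (ends G ` edges G)"
    and x: "x \<in> verts G" and y: "y \<in> verts G"
  shows "\<exists>vs es. walk G vs es \<and> hd vs = x \<and> last vs = y \<and> distinct vs"
proof -
  have fin: "finite (verts G)" and wi: "within (verts G) (ends G ` edges G)"
    using G by (auto simp: multigraph_def within_def)
  \<comment> \<open>Since the walk stays inside \<open>U\<close>, the next vertex, taken outside
    \<open>U\<close>, is new; this keeps the walk free of repetitions.\<close>
  let ?P = "\<lambda>U. \<forall>z\<in>U. \<exists>vs es. walk G vs es \<and> hd vs = x \<and> last vs = z \<and> distinct vs \<and> set vs \<subseteq> U"
  have "?P (verts G)"
  proof (rule cut_induct[where P = ?P, OF con fin wi x])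
    have "walk G [x] []" using x by (simp add: walk_def)
    then show "?P {x}" by fastforce
  next
    fix U a b
    assume U: "?P U" and a: "a \<in> U" and b: "b \<in> verts G - U" and ab: "Upair a b \<in> ends G ` edges G"
    obtain e where e: "e \<in> edges G" "ends G e = Upair a b" using ab by auto
    obtain vs es where vs: "walk G vs es" "hd vs = x" "last vs = a" "distinct vs" "set vs \<subseteq> U"
      using U a by blast
    have ne: "vs \<noteq> []" "length vs = Suc (length es)" using vs(1) by (auto simp: walk_def)
    have "walk G (vs @ [b]) (es @ [e])"
      unfolding walk_def
    proof (intro conjI allI impI)
      fix i assume i: "i < length (es @ [e])"
      show "ends G ((es @ [e]) ! i) = Upair ((vs @ [b]) ! i) ((vs @ [b]) ! Suc i)"
      proof (cases "i < length es")
        case True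
        then show ?thesis using vs(1) ne by (auto simp: walk_def nth_append)
      next
        case False
        then have "i = length es" using i by simp
        moreover have "vs ! length es = a" using vs(3) ne by (simp add: last_conv_nth)
        ultimately show ?thesis using ne e by (simp add: nth_append)
      qed
    qed (use vs(1) b e in \<open>auto simp: walk_def\<close>)
    moreover have "hd (vs @ [b]) = x" "last (vs @ [b]) = b" "distinct (vs @ [b])" "set (vs @ [b]) \<subseteq> insert b U"
      using vs ne b by auto
    ultimately have "\<exists>vs es. walk G vs es \<and> hd vs = x \<and> last vs = b \<and> distinct vs \<and> set vs \<subseteq> insert b U"
      by blast
    then show "?P (insert b U)" using U by blast
  qed
  then show ?thesis using y by blast
qed

lemma connected_iff_cut_connected:
  assumes G: "multigraph G"
  shows "connected G \<longleftrightarrow> cut_connected (verts G) (ends G ` edges G)"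
proof
  assume c: "connected G"
  show "cut_connected (verts G) (ends G ` edges G)"
    unfolding cut_connected_def
  proof (intro conjI allI impI)
    show "verts G \<noteq> {}" using c by (simp add: connected_def)
    fix U assume U: "U \<subseteq> verts G" "U \<noteq> {}" "U \<noteq> verts G"
    then obtain x y where xy: "x \<in> U" "y \<in> verts G" "y \<notin> U" by blast
    then obtain vs es where w: "walk G vs es" "hd vs = x" "last vs = y"
      using c U unfolding connected_def by blast
    then have "length vs = Suc (length es)" by (simp add: walk_def)
    moreover from this have "vs \<noteq> []" by auto
    ultimately have "vs ! 0 = x" "vs ! length es = y"
      using w by (auto simp: last_conv_nth hd_conv_nth)
    then obtain l where "l < length es" "crosses U (ends G (es ! l))"
      using walk_crossing[OF w(1), of 0 "length es" U] xy by auto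
    moreover have "es ! l \<in> edges G" if "l < length es" for l
      using w(1) that by (auto simp: walk_def)
    ultimately show "\<exists>u\<in>ends G ` edges G. crosses U u" by blast
  qed
next
  assume c: "cut_connected (verts G) (ends G ` edges G)"
  then show "connected G"
    using cut_connected_distinct_walk[OF G c] unfolding connected_def cut_connected_def by meson
qed

text \<open>Forwards, an edge outside a connected spanning subset with
  \<open>card (verts G) - 1\<close> edges would close a cycle. Backwards, an edge of a cycle can be
  deleted without disconnecting the graph, which leaves too few edges.\<close>

lemma tree_iff_spans:
  assumes G: "multigraph G"
  shows "tree G \<longleftrightarrow> spans (verts G) (card (edges G)) (ends G ` edges G)"
proof -
  have fin: "finite (verts G)" "finite (edges G)" and wi: "within (verts G) (ends G ` edges G)"
    using G by (auto simp: multigraph_def within_def)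
  show ?thesis
  proof
    assume t: "tree G"
    then have con: "cut_connected (verts G) (ends G ` edges G)"
      using connected_iff_cut_connected[OF G] by (simp add: tree_def)
    obtain B where B: "B \<subseteq> edges G" "card B + 1 = card (verts G)" "cut_connected (verts G) (ends G ` B)"
      using cut_connected_spanning_tree[OF con fin wi] by blast
    have "edges G \<subseteq> B"
    proof
      fix e assume e: "e \<in> edges G"
      obtain x y where xy: "ends G e = Upair x y" by (cases "ends G e")
      then have V: "x \<in> verts G" "y \<in> verts G" using G e by (auto simp: multigraph_def)
      show "e \<in> B"
      proof (rule ccontr)
        assume eB: "e \<notin> B"
        let ?H = "G\<lparr>edges := B\<rparr>"
        have H: "multigraph ?H" using G B finite_subset[OF B(1)] by (auto simp: multigraph_def)
        then obtain vs es where w: "walk ?H vs es" "hd vs = x" "last vs = y" "distinct vs"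
          using cut_connected_distinct_walk[OF H, of x y] B(3) V by auto
        have len: "length vs = Suc (length es)" and es: "set es \<subseteq> B" using w(1) by (auto simp: walk_def)
        have nth: "ends G (es ! i) = Upair (vs ! i) (vs ! Suc i)" if "i < length es" for i
          using w(1) that by (simp add: walk_def)
        have "distinct es"
          unfolding distinct_conv_nth
        proof (intro allI impI notI)
          fix i j assume ij: "i < length es" "j < length es" "i \<noteq> j" "es ! i = es ! j"
          then have "Upair (vs ! i) (vs ! Suc i) = Upair (vs ! j) (vs ! Suc j)" using nth by metis
          then have "vs ! i = vs ! j \<or> vs ! i = vs ! Suc j \<and> vs ! Suc i = vs ! j" by auto
          then show False using ij len w(4) by (auto simp: nth_eq_iff_index_eq)
        qed
        \<comment> \<open>The closed walk goes from \<open>y\<close> along \<open>e\<close> to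
          \<open>x\<close> and back to \<open>y\<close> inside \<open>B\<close>. If \<open>e\<close>
          is a loop, \<open>vs\<close> consists of the single vertex \<open>x\<close>.\<close>
        moreover have "walk G (y # vs) (e # es)"
          unfolding walk_def
        proof (intro conjI allI impI)
          fix i assume i: "i < length (e # es)"
          have "vs ! 0 = x" using w(2) len by (cases vs) auto
          then show "ends G ((e # es) ! i) = Upair ((y # vs) ! i) ((y # vs) ! Suc i)"
            using i nth xy by (cases i) auto
        qed (use w(1) len es e V B(1) in \<open>auto simp: walk_def\<close>)
        moreover have "last (y # vs) = y" using w(3) len by auto
        ultimately have "cycle G (y # vs) (e # es)"
          using w(4) es eB by (auto simp: cycle_def)
        then show False using t by (auto simp: tree_def)
      qed
    qed
    then have "B = edges G" using B(1) by blast
    then show "spans (verts G) (card (edges G)) (ends G ` edges G)"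
      using B by (simp add: spans_def)
  next
    assume s: "spans (verts G) (card (edges G)) (ends G ` edges G)"
    have "\<not> cycle G vs es" for vs es
    proof
      assume c: "cycle G vs es"
      then have w: "walk G vs es" "es \<noteq> []" "hd vs = last vs" "distinct es" by (auto simp: cycle_def)
      have len: "length vs = Suc (length es)" and esG: "set es \<subseteq> edges G" using w(1) by (auto simp: walk_def)
      let ?e = "es ! 0"
      have e: "?e \<in> edges G" using esG w(2) by (cases es) auto
      have e_ends: "ends G ?e = Upair (vs ! 0) (vs ! 1)" using w(1,2) by (simp add: walk_def)
      have closing: "vs ! length es = vs ! 0"
      proof -
        have "vs \<noteq> []" using len by auto
        then show ?thesis using w(3) len by (simp add: last_conv_nth hd_conv_nth)
      qed
      \<comment> \<open>A cut crossed by the first edge of the cycle is also crossed by the rest of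
        the cycle, which joins the same two vertices.\<close>
      have "cut_connected (verts G) (ends G ` (edges G - {?e}))"
        unfolding cut_connected_def
      proof (intro conjI allI impI)
        show "verts G \<noteq> {}" using s by (auto simp: spans_def)
        fix U assume U: "U \<subseteq> verts G" "U \<noteq> {}" "U \<noteq> verts G"
        then obtain f where f: "f \<in> edges G" "crosses U (ends G f)"
          using s unfolding spans_def cut_connected_def by blast
        show "\<exists>u\<in>ends G ` (edges G - {?e}). crosses U u"
        proof (cases "f = ?e")
          case True
          then have "vs ! 1 \<in> U \<longleftrightarrow> vs ! length es \<notin> U" using f(2) e_ends closing by auto
          moreover have "1 \<le> length es" using w(2) by (cases es) auto
          ultimately obtain l where l: "1 \<le> l" "l < length es" "crosses U (ends G (es ! l))"
            using walk_crossing[OF w(1), of 1 "length es" U] by blast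
          have "es ! l \<noteq> ?e" using l w(2,4) by (auto simp: nth_eq_iff_index_eq)
          moreover have "es ! l \<in> edges G" using esG l(2) by auto
          ultimately show ?thesis using l(3) by blast
        qed (use f in blast)
      qed
      moreover have "within (verts G) (ends G ` (edges G - {?e}))" using wi by (auto simp: within_def)
      ultimately have "card (verts G) \<le> card (edges G - {?e}) + 1"
        using fin by (intro cut_connected_card) auto
      then show False using s e fin card_Suc_Diff1[of "edges G" ?e] by (simp add: spans_def)
    qed
    then show "tree G"
      using s connected_iff_cut_connected[OF G] by (auto simp: tree_def spans_def)
  qed
qed

lemma spanning_tree_iff_spans:
  assumes "multigraph G"
  shows "spanning_tree G T \<longleftrightarrow> T \<subseteq> edges G \<and> spans (verts G) (card T) (ends G ` T)"
proof (cases "T \<subseteq> edges G")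
  case True
  then have "multigraph (G\<lparr>edges := T\<rparr>)"
    using assms finite_subset[OF True] by (auto simp: multigraph_def)
  then show ?thesis using True by (simp add: spanning_tree_def tree_iff_spans)
qed (simp add: spanning_tree_def)

section \<open>Degrees\<close>

text \<open>The contribution of an edge to the degree of \<open>v\<close>; it turns degree counts
  into exchanges of sums.\<close>

definition end_mult :: "'v \<Rightarrow> 'v uprod \<Rightarrow> nat" where
  "end_mult v u = of_bool (v \<in> set_uprod u) + of_bool (u = Upair v v)"

lemma end_mult_Upair [simp]: "end_mult v (Upair x y) = of_bool (x = v) + of_bool (y = v)"
  by (auto simp: end_mult_def)

lemma degree_eq_sum:
  assumes "finite (edges G)"
  shows "degree G v = (\<Sum>e\<in>edges G. end_mult v (ends G e))"
  using assms
  by (simp add: degree_def incident_def loops_def end_mult_def sum.distrib Int_def of_bool_def sum.If_cases)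

lemma card_edges_regular:
  assumes G: "multigraph G" and reg: "regular (2 * k) G"
  shows "card (edges G) = k * card (verts G)"
proof -
  have fin: "finite (verts G)" "finite (edges G)" using G by (auto simp: multigraph_def)
  have "2 * k * card (verts G) = (\<Sum>v\<in>verts G. degree G v)"
    using reg by (simp add: regular_def mult.commute)
  also have "\<dots> = (\<Sum>v\<in>verts G. \<Sum>e\<in>edges G. end_mult v (ends G e))"
    using fin by (simp add: degree_eq_sum)
  also have "\<dots> = (\<Sum>e\<in>edges G. \<Sum>v\<in>verts G. end_mult v (ends G e))" by (rule sum.swap)
  also have "\<dots> = (\<Sum>e\<in>edges G. 2)"
  proof (rule sum.cong[OF refl])
    fix e assume "e \<in> edges G"
    obtain x y where xy: "ends G e = Upair x y" by (cases "ends G e")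
    then have "x \<in> verts G" "y \<in> verts G" using G \<open>e \<in> edges G\<close> by (auto simp: multigraph_def)
    then show "(\<Sum>v\<in>verts G. end_mult v (ends G e)) = 2"
      using fin by (simp add: xy sum.distrib of_bool_def)
  qed
  finally show ?thesis by simp
qed

lemma multigraph_del_vertex: "multigraph G \<Longrightarrow> multigraph (del_vertex G v)"
  by (auto simp: multigraph_def del_vertex_def incident_def)

section \<open>Tree colourings after deleting a vertex\<close>

text \<open>\<open>card (tree_colourings (del_vertex G w) k)\<close> is the number N(G, w) of the
  overview.\<close>

definition tree_colourings :: "('v, 'e) mgraph \<Rightarrow> nat \<Rightarrow> ('e \<Rightarrow> nat) set" where
  "tree_colourings G k = colourings (edges G) k (\<lambda>_ T. spans (verts G) (card T) (ends G ` T))"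

lemma sum_card_fibres:
  fixes c :: "'e \<Rightarrow> nat"
  assumes "finite E" "c \<in> E \<rightarrow> {..<k}"
  shows "(\<Sum>i<k. card {e \<in> E. c e = i}) = card E"
  using sum.group[of E "{..<k}" c "\<lambda>_. 1 :: nat"] assms by (simp add: image_subset_iff Pi_iff)

text \<open>A loop at \<open>w\<close> leaves fewer than \<open>2 * k\<close> edges incident to
  \<open>w\<close>, so more edges survive than \<open>k\<close> spanning trees can hold. A loop
  elsewhere would belong to one of the trees, which would stay connected without it and then have
  too few edges.\<close>

lemma tree_colourings_has_loop:
  assumes G: "multigraph G" and reg: "regular (2 * k) G" and loop: "has_loop G" and w: "w \<in> verts G"
  shows "tree_colourings (del_vertex G w) k = {}"
proof (rule equals0I)
  let ?H = "del_vertex G w"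
  fix c assume "c \<in> tree_colourings ?H k"
  then have c: "c \<in> edges ?H \<rightarrow>\<^sub>E {..<k}"
    and tr: "\<And>i. i < k \<Longrightarrow> spans (verts ?H) (card {e \<in> edges ?H. c e = i}) (ends G ` {e \<in> edges ?H. c e = i})"
    by (auto simp: tree_colourings_def colourings_def del_vertex_def)
  have fin: "finite (verts G)" "finite (edges G)" using G by (auto simp: multigraph_def)
  have H: "multigraph ?H" using G by (rule multigraph_del_vertex)
  have finH: "finite (edges ?H)" "finite (verts ?H)" using H by (simp_all add: multigraph_def)
  obtain u e where e: "e \<in> edges G" "ends G e = Upair u u"
    using loop by (auto simp: has_loop_def loops_def)
  show False
  proof (cases "u = w")
    case True
    have "card (verts ?H) + 1 = card (verts G)"
      using fin w card_Suc_Diff1[of "verts G" w] by (simp add: del_vertex_def)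
    then have "card {e \<in> edges ?H. c e = i} + 2 = card (verts G)" if "i < k" for i
      using tr[OF that] by (simp add: spans_def)
    then have "(\<Sum>i<k. card {e \<in> edges ?H. c e = i} + 2) = k * card (verts G)" by simp
    moreover have "(\<Sum>i<k. card {e \<in> edges ?H. c e = i} + 2) = card (edges ?H) + 2 * k"
      unfolding sum.distrib using sum_card_fibres[of "edges ?H" c k] c finH(1) by (simp add: PiE_def)
    ultimately have "card (edges ?H) + 2 * k = card (edges G)"
      using card_edges_regular[OF G reg] by simp
    moreover have inc: "incident G w \<subseteq> edges G" by (auto simp: incident_def)
    have "card (edges ?H) + card (incident G w) = card (edges G)"
      using card_Diff_subset[OF finite_subset[OF inc fin(2)] inc] card_mono[OF fin(2) inc]
      by (simp add: del_vertex_def)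
    moreover have "card (incident G w) + card (loops G w) = 2 * k"
      using reg w by (simp add: regular_def degree_def)
    moreover have "card (loops G w) > 0"
      using e True fin(2) by (auto simp: loops_def card_gt_0_iff)
    ultimately show False by simp
  next
    case False
    then have eH: "e \<in> edges ?H" using e by (auto simp: del_vertex_def incident_def)
    define T where "T = {f \<in> edges ?H. c f = c e}"
    have T: "e \<in> T" "T \<subseteq> edges ?H" using eH by (auto simp: T_def)
    have finT: "finite T" using T(2) finH(1) by (rule finite_subset)
    have s: "spans (verts ?H) (card T) (ends G ` T)"
      using tr[of "c e"] c eH by (auto simp: T_def)
    have "cut_connected (verts ?H) (ends G ` (T - {e}))"
      unfolding cut_connected_def
    proof (intro conjI allI impI)
      show "verts ?H \<noteq> {}" using s by (auto simp: spans_def cut_connected_def)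
      fix U assume "U \<subseteq> verts ?H" "U \<noteq> {}" "U \<noteq> verts ?H"
      then obtain f where f: "f \<in> T" "crosses U (ends G f)"
        using s unfolding spans_def cut_connected_def by blast
      then have "f \<noteq> e" using e(2) by auto
      then show "\<exists>u\<in>ends G ` (T - {e}). crosses U u" using f by blast
    qed
    moreover have "within (verts ?H) (ends G ` (T - {e}))"
      using H T by (auto simp: within_def multigraph_def del_vertex_def)
    ultimately have "card (verts ?H) \<le> card (T - {e}) + 1"
      using finH finT by (intro cut_connected_card) auto
    then show False using s T(1) finT card_Suc_Diff1[of T e] by (simp add: spans_def)
  qed
qed

section \<open>Expanding a vertex\<close>

locale loopless_vertex =
  fixes G :: "('v, 'e) mgraph" and v :: 'v
  assumes G: "multigraph G" and loopless: "\<not> has_loop G" and v: "v \<in> verts G"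
begin

abbreviation q :: "'e \<Rightarrow> 'v" where "q \<equiv> other_end G v"

abbreviation label :: "'e set \<Rightarrow> 'e" where "label \<equiv> \<lambda>p. SOME e. e \<in> p"

abbreviation expand :: "'e set set \<Rightarrow> ('v, 'e) mgraph" where "expand \<equiv> apply_transition G v"

lemma finite_verts: "finite (verts G)" and finite_edges: "finite (edges G)"
  using G by (auto simp: multigraph_def)

lemma finite_incident: "finite (incident G u)"
  using finite_edges by (simp add: incident_def)

lemma ends_incident:
  assumes "a \<in> incident G v"
  shows "ends G a = Upair v (q a)" "q a \<noteq> v" "q a \<in> verts G"
proof -
  obtain w where w: "ends G a = Upair v w"
    using assms by (cases "ends G a") (auto simp: incident_def)
  then have "q a = w" by (rule other_end_eq)
  then show "ends G a = Upair v (q a)" using w by simp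
  then show "q a \<noteq> v" "q a \<in> verts G"
    using assms loopless G by (auto simp: has_loop_def loops_def incident_def multigraph_def)
qed

lemma transitions_eq: "transitions G v = pairings (incident G v)"
  by (simp add: transitions_def pairings_def)

section \<open>The graph obtained from a transition\<close>

context
  fixes \<tau> assumes \<tau>: "\<tau> \<in> transitions G v"
begin

lemma \<tau>_pairings: "\<tau> \<in> pairings (incident G v)"
  using \<tau> by (simp add: transitions_eq)

lemma finite_\<tau>: "finite \<tau>"
  using pairings_finite[OF \<tau>_pairings finite_incident] .

lemma label_mem: "p \<in> \<tau> \<Longrightarrow> label p \<in> p"
proof -
  assume "p \<in> \<tau>"
  then have "card p = 2" using pairings_pairs[OF \<tau>_pairings] by (auto simp: pairs_def)
  then have "p \<noteq> {}" by auto
  then show ?thesis by (simp add: some_in_eq)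
qed

lemma label_incident: "p \<in> \<tau> \<Longrightarrow> label p \<in> incident G v"
  using label_mem pairings_Union[OF \<tau>_pairings] by blast

lemma pair_cases:
  assumes "p \<in> \<tau>"
  obtains a b where "p = {a, b}" "a \<noteq> b" "a \<in> incident G v" "b \<in> incident G v"
  using pairs_doubleton[OF pairings_pairs[OF \<tau>_pairings assms]] .

lemma ends_expand_label: "p \<in> \<tau> \<Longrightarrow> ends (expand \<tau>) (label p) = join q p"
proof -
  assume p: "p \<in> \<tau>"
  obtain a b where ab: "p = {a, b}" "a \<noteq> b" "a \<in> incident G v" "b \<in> incident G v"
    using pair_cases[OF p] .
  then show ?thesis
    using ends_apply_transition[OF \<tau> _ ab(2) ends_incident(1)[OF ab(3)] ends_incident(1)[OF ab(4)]] p
    by (simp add: join_eq)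
qed

lemma ends_expand_old: "e \<notin> incident G v \<Longrightarrow> ends (expand \<tau>) e = ends G e"
  by (simp add: apply_transition_def)

lemma verts_expand: "verts (expand \<tau>) = verts G - {v}"
  by (simp add: apply_transition_def)

lemma edges_expand: "edges (expand \<tau>) = (edges G - incident G v) \<union> label ` \<tau>"
  by (simp add: apply_transition_def)

lemma multigraph_expand: "multigraph (expand \<tau>)"
  unfolding multigraph_def
proof (intro conjI ballI)
  show "finite (verts (expand \<tau>))" using finite_verts by (simp add: verts_expand)
  show "finite (edges (expand \<tau>))" using finite_edges finite_\<tau> by (simp add: edges_expand)
  fix e assume "e \<in> edges (expand \<tau>)"
  then consider "e \<in> edges G - incident G v" | p where "p \<in> \<tau>" "e = label p"
    unfolding edges_expand by blast
  then show "set_uprod (ends (expand \<tau>) e) \<subseteq> verts (expand \<tau>)"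
  proof cases
    case 1
    then show ?thesis
      using G by (auto simp: ends_expand_old verts_expand multigraph_def incident_def)
  next
    case (2 p)
    obtain a b where ab: "p = {a, b}" "a \<noteq> b" "a \<in> incident G v" "b \<in> incident G v"
      using pair_cases[OF 2(1)] .
    have "ends (expand \<tau>) e = Upair (q a) (q b)"
      using ends_expand_label[OF 2(1)] 2(2) ab by (simp add: join_eq)
    then show ?thesis using ends_incident[OF ab(3)] ends_incident[OF ab(4)] by (simp add: verts_expand)
  qed
qed

text \<open>The new edge for \<open>{a, b}\<close> ends at \<open>q a\<close> and
  \<open>q b\<close>, so every edge at \<open>v\<close> keeps its contribution to the degree of its
  other end.\<close>

lemma degree_expand:
  assumes "u \<noteq> v"
  shows "degree (expand \<tau>) u = degree G u"
proof -
  have inc: "incident G v \<subseteq> edges G" by (auto simp: incident_def)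
  have "degree (expand \<tau>) u = (\<Sum>e\<in>edges G - incident G v. end_mult u (ends (expand \<tau>) e)) +
      (\<Sum>e\<in>label ` \<tau>. end_mult u (ends (expand \<tau>) e))"
    using multigraph_expand finite_edges finite_\<tau> label_incident
    by (subst degree_eq_sum) (auto simp: multigraph_def edges_expand intro!: sum.union_disjoint)
  also have "(\<Sum>e\<in>edges G - incident G v. end_mult u (ends (expand \<tau>) e)) =
      (\<Sum>e\<in>edges G - incident G v. end_mult u (ends G e))"
    by (intro sum.cong) (auto simp: ends_expand_old)
  also have "(\<Sum>e\<in>label ` \<tau>. end_mult u (ends (expand \<tau>) e)) = (\<Sum>p\<in>\<tau>. end_mult u (join q p))"
    by (subst sum.reindex[OF inj_on_transition_label[OF \<tau>]]) (simp add: ends_expand_label)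
  also have "\<dots> = (\<Sum>p\<in>\<tau>. \<Sum>a\<in>p. of_bool (q a = u))"
  proof (rule sum.cong[OF refl])
    fix p assume "p \<in> \<tau>"
    then obtain a b where "p = {a, b}" "a \<noteq> b" by (rule pair_cases)
    then show "end_mult u (join q p) = (\<Sum>a\<in>p. of_bool (q a = u))" by (simp add: join_eq)
  qed
  also have "\<dots> = (\<Sum>a\<in>\<Union>\<tau>. of_bool (q a = u))"
  proof -
    have "finite p" if "p \<in> \<tau>" for p using pair_cases[OF that] by (metis finite.emptyI finite.insertI)
    then show ?thesis
      using pairings_disjoint[OF \<tau>_pairings] by (subst sum.Union_disjoint) auto
  qed
  also have "\<dots> = (\<Sum>e\<in>incident G v. end_mult u (ends G e))"
    unfolding pairings_Union[OF \<tau>_pairings] using assms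
    by (intro sum.cong) (auto simp: ends_incident(1))
  also have "(\<Sum>e\<in>edges G - incident G v. end_mult u (ends G e)) + \<dots> = degree G u"
    using finite_edges by (simp add: degree_eq_sum sum.subset_diff[OF inc])
  finally show ?thesis .
qed

lemma regular_expand: "regular d G \<Longrightarrow> regular d (expand \<tau>)"
  by (auto simp: regular_def verts_expand degree_expand)

end

section \<open>The expansion identity\<close>

text \<open>For a fixed colouring of the edges avoiding \<open>v\<close> and \<open>w\<close>, both
  sides become convolutions over the edges from \<open>v\<close> to other vertices. On the right, a
  pair of edges between \<open>v\<close> and \<open>w\<close> becomes a loop and contributes
  nothing, while a pair with just one such edge becomes an edge at \<open>w\<close> and is deleted.
  This gives the factor \<open>level (card C)\<close>, and regularity makes it exactly the missing
  difference of the exponents.\<close>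

lemma card_tree_colourings_expand:
  assumes reg: "regular (2 * k) G" and w: "w \<in> verts G" "w \<noteq> v" and card: "3 \<le> card (verts G)"
  shows "card (tree_colourings (del_vertex G w) k) =
    (\<Sum>\<tau>\<in>transitions G v. card (tree_colourings (del_vertex (expand \<tau>) w) k))"
proof -
  \<comment> \<open>\<open>C\<close> collects the edges between \<open>v\<close> and
    \<open>w\<close>, and \<open>D\<close> the edges from \<open>v\<close> into
    \<open>V\<close>.\<close>
  define V where "V = verts G - {v} - {w}"
  define E where "E = edges G - incident G v - incident G w"
  define C where "C = incident G v \<inter> incident G w"
  define D where "D = incident G v - incident G w"
  define F where "F = (\<lambda>(c :: 'e \<Rightarrow> nat) i. {e \<in> E. c e = i})"
  \<comment> \<open>The conditions on a class whose part \<open>F c i\<close> in \<open>E\<close> is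
    fixed: \<open>st\<close> in \<open>G\<close> without \<open>w\<close>, where \<open>S\<close>
    attaches \<open>v\<close>; \<open>pr\<close> in the expanded graph without \<open>w\<close>,
    where \<open>\<mu>\<close> is a set of new edges.\<close>
  define st where "st = (\<lambda>c i S. spans (insert v V) (card (F c i) + card S) (ends G ` F c i \<union> star v q S))"
  define pr where "pr = (\<lambda>c i \<mu>. spans V (card (F c i) + card \<mu>) (ends G ` F c i \<union> join q ` \<mu>))"
  have finE: "finite E" "finite D" "finite C" "finite V"
    using finite_edges finite_verts finite_incident by (simp_all add: E_def D_def C_def V_def)
  have vV: "v \<notin> V" "insert v V = verts G - {w}" using v w by (auto simp: V_def)
  have DC: "D \<union> C = incident G v" "C \<inter> D = {}" "E \<inter> D = {}" by (auto simp: D_def C_def E_def)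
  have qw: "q a = w \<longleftrightarrow> a \<in> C" if "a \<in> incident G v" for a
    using that ends_incident(1)[OF that] w(2) by (auto simp: C_def incident_def)
  have qD: "q ` D \<subseteq> V"
  proof
    fix x assume "x \<in> q ` D"
    then obtain a where a: "a \<in> D" "x = q a" by blast
    then have "a \<in> incident G v" "a \<notin> C" by (auto simp: D_def C_def)
    then show "x \<in> V" using ends_incident[of a] qw[of a] a by (auto simp: V_def)
  qed
  have finF: "finite (F c i)" for c i using finE by (simp add: F_def)
  have withinE: "within V (ends G ` F c i)" for c i
    using G by (auto simp: within_def F_def E_def V_def multigraph_def incident_def)
  have left: "card (tree_colourings (del_vertex G w) k) =
      (\<Sum>c\<in>E \<rightarrow>\<^sub>E {..<k}. convs (\<lambda>i S. of_bool (st c i S)) k D)"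
  proof -
    have "edges (del_vertex G w) = E \<union> D"
      by (auto simp: del_vertex_def E_def D_def incident_def)
    moreover have "verts (del_vertex G w) = insert v V" "ends (del_vertex G w) = ends G"
      using vV by (simp_all add: del_vertex_def)
    ultimately have "card (tree_colourings (del_vertex G w) k) =
        (\<Sum>c\<in>E \<rightarrow>\<^sub>E {..<k}. card (colourings D k
          (\<lambda>i S. spans (insert v V) (card (F c i \<union> S)) (ends G ` (F c i \<union> S)))))"
      unfolding tree_colourings_def F_def using card_colourings_Un[OF finE(1,2) DC(3)] by simp
    also have "\<dots> = (\<Sum>c\<in>E \<rightarrow>\<^sub>E {..<k}. card (colourings D k (st c)))"
    proof (rule sum.cong[OF refl], rule arg_cong[where f = card], rule colourings_cong)
      fix c i S assume S: "S \<subseteq> D"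
      have "F c i \<inter> S = {}" using S DC(3) by (auto simp: F_def)
      then have "card (F c i \<union> S) = card (F c i) + card S"
        using finF finite_subset[OF S finE(2)] by (rule card_Un_disjoint[rotated 2])
      moreover have "ends G ` (F c i \<union> S) = ends G ` F c i \<union> star v q S"
      proof -
        have "ends G ` S = star v q S"
          unfolding star_def using S by (intro image_cong refl ends_incident(1)) (auto simp: D_def)
        then show ?thesis by (simp add: image_Un)
      qed
      ultimately show "spans (insert v V) (card (F c i \<union> S)) (ends G ` (F c i \<union> S)) \<longleftrightarrow> st c i S"
        by (simp add: st_def)
    qed
    also have "\<dots> = (\<Sum>c\<in>E \<rightarrow>\<^sub>E {..<k}. convs (\<lambda>i S. of_bool (st c i S)) k D)"
      using finE(2) by (simp add: card_colourings)
    finally show ?thesis .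
  qed
  have right: "card (tree_colourings (del_vertex (expand \<tau>) w) k) =
      (\<Sum>c\<in>E \<rightarrow>\<^sub>E {..<k}. if \<forall>p\<in>\<tau>. \<not> p \<subseteq> C then card (colourings {p \<in> \<tau>. p \<subseteq> D} k (pr c)) else 0)"
    if \<tau>: "\<tau> \<in> transitions G v" for \<tau>
  proof (cases "\<forall>p\<in>\<tau>. \<not> p \<subseteq> C")
    case False
    then obtain p where p: "p \<in> \<tau>" "p \<subseteq> C" by blast
    obtain a b where ab: "p = {a, b}" "a \<noteq> b" "a \<in> incident G v" "b \<in> incident G v"
      using pair_cases[OF \<tau> p(1)] .
    have "ends (expand \<tau>) (label p) = Upair w w"
      using ends_expand_label[OF \<tau> p(1)] ab p(2) qw[OF ab(3)] qw[OF ab(4)] by (simp add: join_eq)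
    then have "has_loop (expand \<tau>)"
      using p(1) by (auto simp: has_loop_def loops_def edges_expand[OF \<tau>])
    then have "tree_colourings (del_vertex (expand \<tau>) w) k = {}"
      using w by (intro tree_colourings_has_loop multigraph_expand[OF \<tau>] regular_expand[OF \<tau> reg])
        (simp_all add: verts_expand[OF \<tau>])
    then show ?thesis unfolding if_not_P[OF False] by simp
  next
    case True
    let ?M = "{p \<in> \<tau>. p \<subseteq> D}"
    let ?H = "del_vertex (expand \<tau>) w"
    have M: "finite ?M" "inj_on label ?M"
      using finite_\<tau>[OF \<tau>] inj_on_transition_label[OF \<tau>] by (auto intro: inj_on_subset)
    \<comment> \<open>Of the new edges, exactly those for pairs inside \<open>D\<close> survive the
      deletion of \<open>w\<close>.\<close>
    have inc: "label p \<in> incident (expand \<tau>) w \<longleftrightarrow> \<not> p \<subseteq> D" if p: "p \<in> \<tau>" for p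
    proof -
      obtain a b where ab: "p = {a, b}" "a \<noteq> b" "a \<in> incident G v" "b \<in> incident G v"
        using pair_cases[OF \<tau> p] .
      have "w \<in> set_uprod (ends (expand \<tau>) (label p)) \<longleftrightarrow> q a = w \<or> q b = w"
        using ends_expand_label[OF \<tau> p] ab by (auto simp: join_eq)
      also have "\<dots> \<longleftrightarrow> \<not> p \<subseteq> D"
        using qw[OF ab(3)] qw[OF ab(4)] ab DC by blast
      finally show ?thesis using p by (simp add: incident_def edges_expand[OF \<tau>])
    qed
    have old: "e \<in> incident (expand \<tau>) w \<longleftrightarrow> e \<in> incident G w" if "e \<in> edges G - incident G v" for e
      using that by (auto simp: incident_def edges_expand[OF \<tau>] ends_expand_old[OF \<tau>])
    have "edges ?H = E \<union> label ` ?M"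
    proof -
      have "edges ?H = (edges G - incident G v - incident (expand \<tau>) w) \<union>
          (label ` \<tau> - incident (expand \<tau>) w)"
        by (auto simp: del_vertex_def edges_expand[OF \<tau>])
      also have "edges G - incident G v - incident (expand \<tau>) w = E"
        unfolding E_def using old by blast
      also have "label ` \<tau> - incident (expand \<tau>) w = label ` ?M" using inc by blast
      finally show ?thesis .
    qed
    moreover have "verts ?H = V" by (simp add: del_vertex_def verts_expand[OF \<tau>] V_def)
    moreover have "ends ?H = ends (expand \<tau>)" by (simp add: del_vertex_def)
    moreover have disj: "E \<inter> label ` ?M = {}" using label_incident[OF \<tau>] by (auto simp: E_def)
    ultimately have "card (tree_colourings ?H k) = (\<Sum>c\<in>E \<rightarrow>\<^sub>E {..<k}. card (colourings (label ` ?M) k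
        (\<lambda>i S. spans V (card (F c i \<union> S)) (ends (expand \<tau>) ` (F c i \<union> S)))))"
      unfolding tree_colourings_def F_def
      using card_colourings_Un[OF finE(1) finite_imageI[OF M(1)] disj] by simp
    also have "\<dots> = (\<Sum>c\<in>E \<rightarrow>\<^sub>E {..<k}. card (colourings ?M k (pr c)))"
    proof (rule sum.cong[OF refl])
      fix c
      have "card (colourings (label ` ?M) k
            (\<lambda>i S. spans V (card (F c i \<union> S)) (ends (expand \<tau>) ` (F c i \<union> S)))) =
          card (colourings ?M k
            (\<lambda>i S. spans V (card (F c i \<union> label ` S)) (ends (expand \<tau>) ` (F c i \<union> label ` S))))"
        by (rule card_colourings_image[OF M(2)])
      also have "\<dots> = card (colourings ?M k (pr c))"
      proof (rule arg_cong[where f = card], rule colourings_cong)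
        fix i S assume S: "S \<subseteq> ?M"
        have "finite S" using S M(1) by (rule finite_subset)
        have "F c i \<subseteq> E" "label ` S \<subseteq> label ` ?M" using S by (auto simp: F_def)
        then have "F c i \<inter> label ` S = {}" using disj by blast
        then have "card (F c i \<union> label ` S) = card (F c i) + card (label ` S)"
          using finF \<open>finite S\<close> by (intro card_Un_disjoint) auto
        moreover have "card (label ` S) = card S" using inj_on_subset[OF M(2) S] by (rule card_image)
        moreover have "ends (expand \<tau>) ` F c i = ends G ` F c i"
          by (intro image_cong refl ends_expand_old[OF \<tau>]) (auto simp: F_def E_def)
        moreover have "ends (expand \<tau>) ` label ` S = join q ` S"
          unfolding image_image using S by (intro image_cong refl ends_expand_label[OF \<tau>]) auto
        ultimately show "spans V (card (F c i \<union> label ` S)) (ends (expand \<tau>) ` (F c i \<union> label ` S)) \<longleftrightarrow> pr c i S"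
          by (simp add: pr_def image_Un)
      qed
      finally show "card (colourings (label ` ?M) k
            (\<lambda>i S. spans V (card (F c i \<union> S)) (ends (expand \<tau>) ` (F c i \<union> S)))) =
          card (colourings ?M k (pr c))" .
    qed
    finally show ?thesis using True by simp
  qed
  have "(\<Sum>\<tau>\<in>transitions G v. card (tree_colourings (del_vertex (expand \<tau>) w) k)) =
      (\<Sum>\<tau>\<in>pairings (D \<union> C). \<Sum>c\<in>E \<rightarrow>\<^sub>E {..<k}.
        if \<forall>p\<in>\<tau>. \<not> p \<subseteq> C then card (colourings {p \<in> \<tau>. p \<subseteq> D} k (pr c)) else 0)"
    unfolding DC(1) transitions_eq[symmetric] by (intro sum.cong refl right)
  also have "\<dots> = (\<Sum>c\<in>E \<rightarrow>\<^sub>E {..<k}. \<Sum>\<tau>\<in>pairings (D \<union> C).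
        if \<forall>p\<in>\<tau>. \<not> p \<subseteq> C then card (colourings {p \<in> \<tau>. p \<subseteq> D} k (pr c)) else 0)"
    by (rule sum.swap)
  also have "\<dots> = (\<Sum>c\<in>E \<rightarrow>\<^sub>E {..<k}.
      conv (\<lambda>S. \<Sum>\<mu>\<in>pairings S. card (colourings \<mu> k (pr c))) (level (card C)) D)"
    using sum_pairings_bipartite[OF finE(3,2) DC(2)] by (intro sum.cong refl)
  also have "\<dots> = (\<Sum>c\<in>E \<rightarrow>\<^sub>E {..<k}. convs (\<lambda>i S. of_bool (st c i S)) k D)"
  proof (rule sum.cong[OF refl])
    fix c assume c: "c \<in> E \<rightarrow>\<^sub>E {..<k}"
    let ?st = "\<lambda>i S. of_bool (st c i S) :: nat"
    let ?pr = "\<lambda>i S. card (tree_pairings V q (card (F c i)) (ends G ` F c i) S)"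
    have pr: "(\<Sum>\<mu>\<in>pairings S. card (colourings \<mu> k (pr c))) = convs ?pr k S" if "S \<subseteq> D" for S
    proof -
      have finS: "finite S" using that finE(2) by (rule finite_subset)
      have "(\<Sum>\<mu>\<in>pairings S. card (colourings \<mu> k (pr c))) =
          (\<Sum>\<mu>\<in>pairings S. convs (\<lambda>i \<mu>. of_bool (pr c i \<mu>)) k \<mu>)"
        using pairings_finite[OF _ finS] by (intro sum.cong refl card_colourings)
      also have "\<dots> = convs (\<lambda>i S. \<Sum>\<mu>\<in>pairings S. of_bool (pr c i \<mu>)) k S"
        using finS by (rule sum_pairings_convs)
      also have "\<dots> = convs ?pr k S"
      proof -
        have *: "convs h k S = convs h' k S"
          if "finite S" "\<And>i S. finite S \<Longrightarrow> h i S = h' i S" for h h' :: "nat \<Rightarrow> 'e set \<Rightarrow> nat" and S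
          using that(1)
        proof (induction k arbitrary: S)
          case (Suc k)
          then show ?case using that(2) by (auto intro!: conv_cong dest: finite_subset)
        qed simp
        show ?thesis
        proof (rule *[OF finS])
          fix i and S :: "'e set" assume "finite S"
          then show "(\<Sum>\<mu>\<in>pairings S. of_bool (pr c i \<mu>)) = ?pr i S"
            using finite_pairings[of S]
            by (simp add: tree_pairings_def pr_def Int_def of_bool_def sum.If_cases)
        qed
      qed
      finally show ?thesis .
    qed
    have "V \<noteq> {}"
    proof
      assume "V = {}"
      then have "verts G \<subseteq> {v, w}" by (auto simp: V_def)
      then have "card (verts G) \<le> card {v, w}" by (intro card_mono) auto
      also have "\<dots> \<le> 2" by (simp add: card_insert_if)
      finally show False using card by simp
    qed
    then have "\<exists>X p r. r + 2 + card (F c i) = p + card V \<and>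
        (\<forall>S\<subseteq>D. ?st i S = conv X (level p) S \<and> ?pr i S = conv X (level r) S)" for i
      unfolding st_def
      using pair_star_common_factor[OF finE(4) _ finite_imageI[OF finF] withinE card_image_le[OF finF]
          vV(1) finE(2) qD] by blast
    then obtain X p r where X: "r + 2 * k + (\<Sum>i<k. card (F c i)) = p + k * card V"
      "\<forall>S\<subseteq>D. convs ?st k S = conv X (level p) S \<and> convs ?pr k S = conv X (level r) S"
      using convs_common_factor[of D k "\<lambda>i. card (F c i)" "card V" ?st ?pr] finE(2) by blast
    \<comment> \<open>The condition in \<open>X\<close> says
      \<open>r - p = k * card V - card E - 2 * k\<close>. There are \<open>k * (card V + 2)\<close>
      edges in total, of which \<open>4 * k - card C\<close> meet \<open>v\<close> or
      \<open>w\<close>; hence the difference is \<open>- card C\<close>.\<close>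
    have "p = r + card C"
    proof -
      have "(\<Sum>i<k. card (F c i)) = card E"
        unfolding F_def using c finE(1) by (intro sum_card_fibres) (auto simp: PiE_def)
      moreover have "card (incident G u) = 2 * k" if "u \<in> verts G" for u
      proof -
        have "loops G u = {}" using loopless by (auto simp: has_loop_def)
        moreover have "card (incident G u) + card (loops G u) = 2 * k"
          using reg that by (simp add: regular_def degree_def)
        ultimately show ?thesis by simp
      qed
      then have inc: "card (incident G v) = 2 * k" "card (incident G w) = 2 * k" using v w by auto
      moreover have "card (incident G v \<union> incident G w) + card C = 4 * k"
        using card_Un_Int[of "incident G v" "incident G w"] finite_incident inc by (simp add: C_def)
      moreover have "card E + card (incident G v \<union> incident G w) = k * card (verts G)"
      proof -
        have sub: "incident G v \<union> incident G w \<subseteq> edges G" by (auto simp: incident_def)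
        have "E = edges G - (incident G v \<union> incident G w)" by (auto simp: E_def)
        then show ?thesis
          using card_Diff_subset[OF _ sub] card_mono[OF finite_edges sub] finite_incident
            card_edges_regular[OF G reg] by simp
      qed
      moreover have "card (verts G) = card V + 2"
        using finite_verts v w card by (simp add: V_def)
      then have "k * card (verts G) = k * card V + 2 * k" by (simp add: distrib_left)
      ultimately show ?thesis using X(1) by linarith
    qed
    have "conv (\<lambda>S. \<Sum>\<mu>\<in>pairings S. card (colourings \<mu> k (pr c))) (level (card C)) D =
        conv (conv X (level r)) (level (card C)) D"
      using pr X(2) by (intro conv_cong) auto
    also have "\<dots> = conv X (conv (level r) (level (card C))) D" using finE(2) by (rule conv_assoc)
    also have "\<dots> = conv X (level p) D"
      using finE(2) by (intro conv_cong refl) (simp add: conv_level_level finite_subset \<open>p = r + card C\<close>)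
    also have "\<dots> = convs ?st k D" using X(2) by simp
    finally show "conv (\<lambda>S. \<Sum>\<mu>\<in>pairings S. card (colourings \<mu> k (pr c))) (level (card C)) D =
        convs ?st k D" .
  qed
  finally show ?thesis using left by simp
qed

end

section \<open>The Martin invariant counts spanning tree partitions\<close>

text \<open>Expanding a third vertex reduces the comparison of \<open>u\<close> and \<open>w\<close>
  to graphs with fewer vertices, in which both survive. The induction starts at two vertices:
  without loops, deleting one of them leaves no edges and thus only the empty colouring.\<close>

lemma tree_colourings_vertex_independent:
  fixes G :: "('v, 'e) mgraph"
  assumes "multigraph G" "regular (2 * k) G" "2 \<le> card (verts G)" "u \<in> verts G" "w \<in> verts G"
  shows "card (tree_colourings (del_vertex G u) k) = card (tree_colourings (del_vertex G w) k)"
  using assms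
proof (induction "card (verts G)" arbitrary: G rule: less_induct)
  case (less G)
  have fin: "finite (verts G)" using less.prems(1) by (simp add: multigraph_def)
  consider "has_loop G" | "u = w" | "\<not> has_loop G" "u \<noteq> w" "card (verts G) = 2"
    | "\<not> has_loop G" "u \<noteq> w" "3 \<le> card (verts G)"
    using less.prems(3) by linarith
  then show ?case
  proof cases
    case 1
    then show ?thesis
      using tree_colourings_has_loop[OF less.prems(1,2)] less.prems(4,5) by simp
  next
    case 3
    have V: "verts G = {u, w}"
      using card_subset_eq[OF fin, of "{u, w}"] 3 less.prems(4,5) by auto
    have "tree_colourings (del_vertex G x) k = {\<lambda>_. undefined}" if x: "x \<in> verts G" for x
    proof -
      have "e \<in> incident G x" if e: "e \<in> edges G" for e
      proof -
        obtain a b where ab: "ends G e = Upair a b" by (cases "ends G e")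
        then have "a \<noteq> b" using 3(1) e by (auto simp: has_loop_def loops_def)
        then show ?thesis using less.prems(1) e ab x V by (auto simp: incident_def multigraph_def)
      qed
      then have "edges (del_vertex G x) = {}" by (auto simp: del_vertex_def)
      moreover obtain y where "verts (del_vertex G x) = {y}"
        using x V 3(2) by (auto simp: del_vertex_def)
      ultimately show ?thesis
        by (auto simp: tree_colourings_def colourings_def spans_def cut_connected_def)
    qed
    then show ?thesis using less.prems(4,5) by simp
  next
    case 4
    have "\<not> verts G \<subseteq> {u, w}"
    proof
      assume "verts G \<subseteq> {u, w}"
      then have "card (verts G) \<le> card {u, w}" by (intro card_mono) auto
      then show False using 4 by (simp add: card_insert_if)
    qed
    then obtain v where vuw: "v \<in> verts G" "v \<noteq> u" "v \<noteq> w" by blast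
    interpret loopless_vertex G v using less.prems(1) 4(1) vuw(1) by unfold_locales
    have c: "card (verts G - {v}) + 1 = card (verts G)"
      using fin vuw(1) card_Suc_Diff1[of "verts G" v] by simp
    have "card (tree_colourings (del_vertex (expand \<tau>) u) k) = card (tree_colourings (del_vertex (expand \<tau>) w) k)"
      if \<tau>: "\<tau> \<in> transitions G v" for \<tau>
      using less.prems less.hyps[OF _ multigraph_expand[OF \<tau>] regular_expand[OF \<tau>]] c vuw(1) vuw(2,3)[symmetric] 4(3)
      by (simp add: verts_expand[OF \<tau>])
    then show ?thesis
      using card_tree_colourings_expand[OF less.prems(2)] less.prems(4,5) vuw 4(3) by simp
  qed simp
qed

text \<open>Deleting \<open>w\<close> leaves two vertices and \<open>3 * k - 2 * k = k\<close>
  parallel edges. Each tree is a single edge, so the colourings correspond to the bijections between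
  edges and colours.\<close>

lemma card_tree_colourings_three:
  assumes G: "multigraph G" and reg: "regular (2 * k) G" and loopless: "\<not> has_loop G"
    and card: "card (verts G) = 3" and w: "w \<in> verts G"
  shows "card (tree_colourings (del_vertex G w) k) = fact k"
proof -
  let ?H = "del_vertex G w"
  have fin: "finite (verts G)" "finite (edges G)" using G by (auto simp: multigraph_def)
  have H: "multigraph ?H" using G by (rule multigraph_del_vertex)
  then have finH: "finite (edges ?H)" by (simp add: multigraph_def)
  have "card (verts ?H) = 2" using card w fin by (simp add: del_vertex_def)
  then obtain x y where xy: "verts ?H = {x, y}" "x \<noteq> y" by (auto simp: card_2_iff)
  have ends: "ends ?H e = Upair x y" if "e \<in> edges ?H" for e
  proof -
    obtain a b where ab: "ends ?H e = Upair a b" by (cases "ends ?H e")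
    then have "a \<noteq> b" using loopless that by (auto simp: has_loop_def loops_def del_vertex_def)
    then show ?thesis using H that ab xy by (auto simp: multigraph_def)
  qed
  have tr: "spans (verts ?H) (card T) (ends ?H ` T) \<longleftrightarrow> card T = 1" if T: "T \<subseteq> edges ?H" for T
  proof
    assume "card T = 1"
    then obtain e where "T = {e}" by (auto simp: card_1_singleton_iff)
    then have "ends ?H ` T = {Upair x y}" using ends T by auto
    moreover have "cut_connected {x, y} {Upair x y}" by (auto simp: cut_connected_def)
    ultimately show "spans (verts ?H) (card T) (ends ?H ` T)"
      using xy \<open>card T = 1\<close> by (simp add: spans_def)
  qed (use xy in \<open>simp add: spans_def\<close>)
  have "card (edges ?H) = k"
  proof -
    have inc: "incident G w \<subseteq> edges G" by (auto simp: incident_def)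
    have "loops G w = {}" using loopless by (auto simp: has_loop_def)
    moreover have "card (incident G w) + card (loops G w) = 2 * k"
      using reg w by (simp add: regular_def degree_def)
    ultimately have "card (incident G w) = 2 * k" by simp
    then show ?thesis
      using card_Diff_subset[OF finite_subset[OF inc fin(2)] inc] card_edges_regular[OF G reg] card
      by (simp add: del_vertex_def)
  qed
  have "tree_colourings ?H k = colourings (edges ?H) k (\<lambda>_ T. card T = 1)"
    unfolding tree_colourings_def using tr by (intro colourings_cong) auto
  then have "card (tree_colourings ?H k) = convs (\<lambda>i S. of_bool (card S = 1)) k (edges ?H)"
    using finH by (simp add: card_colourings)
  also have "\<dots> = convs (\<lambda>i. level 1) k (edges ?H)"
  proof -
    have "of_bool (card S = 1) = level 1 S" for S :: "'b set" by (simp add: level_def)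
    then show ?thesis by presburger
  qed
  also have "\<dots> = level k (edges ?H)"
    using finH by (rule convs_level_1)
  also have "\<dots> = fact k" using \<open>card (edges ?H) = k\<close> by (simp add: level_def)
  finally show ?thesis .
qed

text \<open>The vertex \<open>w\<close> may be the expanded vertex \<open>v\<close>, whereas the
  expansion identity concerns a surviving vertex. Therefore an auxiliary \<open>u\<close> different
  from \<open>v\<close> is deleted first and exchanged for \<open>w\<close> at the end.\<close>

lemma martin_value_tree_colourings:
  assumes "martin_value G m" "multigraph G" "regular (2 * k) G" "w \<in> verts G"
  shows "fact k * m = card (tree_colourings (del_vertex G w) k)"
  using assms
proof (induction arbitrary: w rule: martin_value.induct)
  case (loop G)
  then show ?case using tree_colourings_has_loop by fastforce
next
  case (three G)
  then show ?case using card_tree_colourings_three by fastforce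
next
  case (expand G v m)
  interpret loopless_vertex G v using expand.hyps expand.prems(1) by unfold_locales
  have "verts G \<noteq> {v}" using expand.hyps(1) by auto
  then obtain u where u: "u \<in> verts G" "u \<noteq> v" using expand.hyps(3) by blast
  have "fact k * (\<Sum>\<tau>\<in>transitions G v. m \<tau>) =
      (\<Sum>\<tau>\<in>transitions G v. card (tree_colourings (del_vertex (apply_transition G v \<tau>) u) k))"
    unfolding sum_distrib_left
  proof (rule sum.cong[OF refl])
    fix \<tau> assume \<tau>: "\<tau> \<in> transitions G v"
    show "fact k * m \<tau> = card (tree_colourings (del_vertex (apply_transition G v \<tau>) u) k)"
      using expand.IH[OF \<tau> multigraph_expand[OF \<tau>] regular_expand[OF \<tau> expand.prems(2)]] u
      by (simp add: verts_expand[OF \<tau>])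
  qed
  also have "\<dots> = card (tree_colourings (del_vertex G u) k)"
    using card_tree_colourings_expand[OF expand.prems(2) u] expand.hyps(1) by simp
  also have "\<dots> = card (tree_colourings (del_vertex G w) k)"
    using expand.hyps(1) expand.prems u by (intro tree_colourings_vertex_independent) auto
  finally show ?case .
qed

text \<open>An expansion loses one vertex and happens only above three vertices, so the lower bound
  is preserved.\<close>

lemma martin_value_exists:
  fixes G :: "('v, 'e) mgraph"
  assumes "multigraph G" "3 \<le> card (verts G)"
  shows "\<exists>m. martin_value G m"
  using assms
proof (induction "card (verts G)" arbitrary: G rule: less_induct)
  case (less G)
  consider "has_loop G" | "\<not> has_loop G" "card (verts G) = 3" | "\<not> has_loop G" "3 < card (verts G)"
    using less.prems(2) by linarith
  then show ?case
  proof cases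
    case 1
    then show ?thesis using martin_value.loop less.prems(2) by blast
  next
    case 2
    then show ?thesis using martin_value.three by blast
  next
    case 3
    then obtain v where v: "v \<in> verts G" by fastforce
    interpret loopless_vertex G v using less.prems(1) 3(1) v by unfold_locales
    have c: "card (verts G - {v}) + 1 = card (verts G)"
      using finite_verts v card_Suc_Diff1[of "verts G" v] by simp
    have "\<exists>m. martin_value (expand \<tau>) m" if \<tau>: "\<tau> \<in> transitions G v" for \<tau>
      using less.hyps[OF _ multigraph_expand[OF \<tau>]] c 3(2) by (simp add: verts_expand[OF \<tau>])
    then obtain m where "\<And>\<tau>. \<tau> \<in> transitions G v \<Longrightarrow> martin_value (expand \<tau>) (m \<tau>)" by metis
    then show ?thesis using martin_value.expand[OF 3(2,1) v] by blast
  qed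
qed

theorem theorem1p3:
  fixes G :: "('v, 'e) mgraph" and v :: 'v and k :: nat
  assumes "multigraph G" and "regular (2 * k) G" and "3 \<le> card (verts G)" and "v \<in> verts G"
  shows "martin G = card (spanning_tree_partitions (del_vertex G v) k)"
proof -
  let ?H = "del_vertex G v"
  obtain m where m: "martin_value G m" using martin_value_exists assms(1,3) by blast
  have val: "fact k * m' = card (tree_colourings ?H k)" if "martin_value G m'" for m'
    using martin_value_tree_colourings[OF that] assms by simp
  \<comment> \<open>Cancelling \<open>fact k\<close> shows that the choices in the recursion do not
    matter, so that \<open>martin\<close> is well defined.\<close>
  have unique: "m' = m" if "martin_value G m'" for m'
    using val[OF that] val[OF m] by (metis fact_nonzero mult_cancel1)
  have "martin G = m" unfolding martin_def using m unique by (rule the_equality)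
  have H: "multigraph ?H" using assms(1) by (rule multigraph_del_vertex)
  have fin: "finite (verts G)" using assms(1) by (simp add: multigraph_def)
  have "card (verts ?H) + 1 = card (verts G)"
    using fin assms(4) card_Suc_Diff1[of "verts G" v] by (simp add: del_vertex_def)
  \<comment> \<open>At least two vertices remain, so each spanning tree has an edge; the colour
    classes are therefore nonempty, as a partition requires.\<close>
  then have ne: "T \<noteq> {}" if "spans (verts ?H) (card T) (ends ?H ` T)" for T
    using that assms(3) by (auto simp: spans_def)
  have "{P. partition_on (edges ?H) P \<and> card P = k \<and> (\<forall>T\<in>P. spans (verts ?H) (card T) (ends ?H ` T))} =
      spanning_tree_partitions ?H k"
    unfolding spanning_tree_partitions_def
    by (intro Collect_cong conj_cong refl ball_cong)
      (auto simp: spanning_tree_iff_spans[OF H] partition_on_def)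
  then have "card (tree_colourings ?H k) = fact k * card (spanning_tree_partitions ?H k)"
    unfolding tree_colourings_def
    using card_colourings_partitions[of "edges ?H" "\<lambda>T. spans (verts ?H) (card T) (ends ?H ` T)" k] H ne
    by (simp add: multigraph_def)
  then have "fact k * m = fact k * card (spanning_tree_partitions ?H k)" using val[OF m] by simp
  then show ?thesis using \<open>martin G = m\<close> by simp
qed

end
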